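(* Let $Q$ be a meromorphic modular form of weight $4$ on $\mathrm{SL}(2,\mathbb Z)$ such that the differential equation $y''(z)=Q(z)y(z)$ on $\mathbb H$ is Fuchsian (also at $\infty$) and satisfies the following conditions. (1) The equation is apparent at every pole $p\in\mathbb H$ of $Q$, with local exponents $\tfrac12\pm\kappa_p$ where $\kappa_p\in\tfrac12\mathbb N$; $\kappa_p>\tfrac12$ for every pole $p$ not $\mathrm{SL}(2,\mathbb Z)$-equivalent to $i$ or $\rho$; and $Q(\infty)\le 0$. (2) $\kappa_i$ and $2\kappa_\rho/3$ are not integers, where $\tfrac12\pm\kappa_i$ and $\tfrac12\pm\kappa_\rho$ are the local exponents at $i$ and $\rho$ (so $\kappa_i=\tfrac12$, resp. $\kappa_\rho=\tfrac12$, if $Q$ is holomorphic at $i$, resp. $\rho$). Suppose that the local exponents at $\infty$ are $\pm\kappa_\infty$ with $\kappa_\infty=n/4$, $n$ a positive odd integer. Let $$y_\pm(z)=q^{\pm n/4}\Bigl(1+\sum_{j\ge1}c_j^\pm q^j\Bigr)$$ be the corresponding solutions of $y''=Qy$. Then there is a constant $c\in\mathbb C$ such that $F(z):=y_-(z)^2+c\,y_+(z)^2$ satisfies $$\bigl(F\big|_{-2}T\bigr)(z)=\bigl(F\big|_{-2}S\bigr)(z)=-F(z).$$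
   Context: $\mathbb H$ is the upper half-plane, $\mathbb N=\{1,2,\dots\}$, $i=\sqrt{-1}$, $\rho=(1+\sqrt{-3})/2$, $q=e^{2\pi iz}$ (with $q^{s}=e^{2\pi isz}$), $'=d/dz$. A meromorphic modular form of weight $4$ on $\mathrm{SL}(2,\mathbb Z)$ is a meromorphic function on $\mathbb H$, meromorphic at $\infty$, with $Q(\gamma z)=(cz+d)^4Q(z)$ for all $\gamma=\begin{pmatrix}a&b\\c&d\end{pmatrix}\in\mathrm{SL}(2,\mathbb Z)$. Fuchsian means that the poles of $Q$ on $\mathbb H$ have order at most $2$ and $Q$ is holomorphic at $\infty$ (with value $Q(\infty)$); local exponents at $\infty$ are exponents in $q$ of $(q\,d/dq)^2y=-\frac{Q}{4\pi^2}y$. Local exponents at $p\in\mathbb H$ are written $\frac12\pm\kappa_p$, $\kappa_p\ge0$. The equation is apparent at a pole $p$ if $\kappa_p\in\frac12\mathbb Z_{\ge0}$ and no solution has a logarithmic singularity at $p$. The solutions $y_\pm$ are defined near $\infty$ and continued analytically; under (1) their squares are single-valued meromorphic functions on $\mathbb H$ (and products of two solutions likewise). $T=\begin{pmatrix}1&1\\0&1\end{pmatrix}$, $S=\begin{pmatrix}0&-1\\1&0\end{pmatrix}$, and $(F|_k\gamma)(z)=(cz+d)^{-k}F(\gamma z)$ for $\gamma=\begin{pmatrix}a&b\\c&d\end{pmatrix}$. *)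

theory Defs
  imports "HOL-Complex_Analysis.Complex_Analysis"
begin

definition uhp :: "complex set" where
  "uhp = {z. Im z > 0}"

definition SL2Z :: "(int ^ 2 ^ 2) set" where
  "SL2Z = {\<gamma>. det \<gamma> = 1}"

definition T_mat :: "int ^ 2 ^ 2" where
  "T_mat = vector [vector [1, 1], vector [0, 1]]"

definition S_mat :: "int ^ 2 ^ 2" where
  "S_mat = vector [vector [0, -1], vector [1, 0]]"

definition moebius :: "int ^ 2 ^ 2 \<Rightarrow> complex \<Rightarrow> complex" where
  "moebius \<gamma> z = (of_int (\<gamma> $ 1 $ 1) * z + of_int (\<gamma> $ 1 $ 2)) /
                 (of_int (\<gamma> $ 2 $ 1) * z + of_int (\<gamma> $ 2 $ 2))"

definition autom_factor :: "int ^ 2 ^ 2 \<Rightarrow> complex \<Rightarrow> complex" where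
  "autom_factor \<gamma> z = of_int (\<gamma> $ 2 $ 1) * z + of_int (\<gamma> $ 2 $ 2)"

definition slash :: "int \<Rightarrow> (complex \<Rightarrow> complex) \<Rightarrow> int ^ 2 ^ 2 \<Rightarrow> complex \<Rightarrow> complex" where
  "slash k F \<gamma> z = autom_factor \<gamma> z powi (- k) * F (moebius \<gamma> z)"

definition SL2Z_equiv :: "complex \<Rightarrow> complex \<Rightarrow> bool" where
  "SL2Z_equiv z w \<longleftrightarrow> (\<exists>\<gamma>\<in>SL2Z. w = moebius \<gamma> z)"

definition rho :: complex where
  "rho = (1 + \<i> * of_real (sqrt 3)) / 2"


definition q_pow :: "complex \<Rightarrow> complex \<Rightarrow> complex" where
  "q_pow s z = exp (2 * of_real pi * \<i> * s * z)"

abbreviation at_ii_inf :: "complex filter" where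
  "at_ii_inf \<equiv> filtercomap Im at_top"

definition has_q_expansion :: "(complex \<Rightarrow> complex) \<Rightarrow> complex fls \<Rightarrow> bool" where
  "has_q_expansion f A \<longleftrightarrow>
     fls_conv_radius A > 0 \<and> (\<forall>\<^sub>F z in at_ii_inf. f z = eval_fls A (q_pow 1 z))"

definition meromorphic_at_ii_inf :: "(complex \<Rightarrow> complex) \<Rightarrow> bool" where
  "meromorphic_at_ii_inf f \<longleftrightarrow> (\<exists>A. has_q_expansion f A)"

definition holomorphic_at_ii_inf :: "(complex \<Rightarrow> complex) \<Rightarrow> bool" where
  "holomorphic_at_ii_inf f \<longleftrightarrow> (\<exists>A. has_q_expansion f A \<and> fls_subdegree A \<ge> 0)"

definition value_at_ii_inf :: "(complex \<Rightarrow> complex) \<Rightarrow> complex" where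
  "value_at_ii_inf f = Lim at_ii_inf f"

text \<open>
  A meromorphic function on \<open>uhp\<close> is represented by its normalised version: removable
  singularities are removed and the value at a pole is \<open>0\<close>. With this convention the
  transformation law makes sense, and is equivalent to the usual one, at poles as well.
\<close>

definition meromorphic_modular_form :: "int \<Rightarrow> (complex \<Rightarrow> complex) \<Rightarrow> bool" where
  "meromorphic_modular_form k f \<longleftrightarrow>
     f nicely_meromorphic_on uhp \<and>
     (\<forall>\<gamma>\<in>SL2Z. \<forall>z\<in>uhp. f (moebius \<gamma> z) = autom_factor \<gamma> z powi k * f z) \<and>
     meromorphic_at_ii_inf f"


definition fuchsian :: "(complex \<Rightarrow> complex) \<Rightarrow> bool" where
  "fuchsian Q \<longleftrightarrow> (\<forall>p\<in>uhp. is_pole Q p \<longrightarrow> zorder Q p \<ge> -2) \<and> holomorphic_at_ii_inf Q"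

definition ode_solution_on ::
    "(complex \<Rightarrow> complex) \<Rightarrow> (complex \<Rightarrow> complex) \<Rightarrow> complex set \<Rightarrow> bool" where
  "ode_solution_on Q y U \<longleftrightarrow>
     y holomorphic_on U \<and> (\<forall>z\<in>U. (deriv ^^ 2) y z = Q z * y z)"

text \<open>
  The local exponents of \<open>y'' = Q y\<close> at \<open>p\<close> are the roots of the indicial equation
  \<open>r (r - 1) = a\<close>, where \<open>a\<close> is the coefficient of \<open>(z - p)\<^sup>-\<^sup>2\<close> in \<open>Q\<close>. At the cusp the equation
  reads \<open>(q d/dq)\<^sup>2 y = - Q / (4 \<pi>\<^sup>2) y\<close>, whence the indicial equation \<open>r\<^sup>2 = - Q(\<infinity>) / (4 \<pi>\<^sup>2)\<close>.
\<close>

definition local_exponents :: "(complex \<Rightarrow> complex) \<Rightarrow> complex \<Rightarrow> complex set" where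
  "local_exponents Q p = {r. ((\<lambda>z. (z - p) ^ 2 * Q z) \<longlongrightarrow> r * (r - 1)) (at p)}"

definition local_exponents_ii_inf :: "(complex \<Rightarrow> complex) \<Rightarrow> complex set" where
  "local_exponents_ii_inf Q = {r. r ^ 2 = - value_at_ii_inf Q / (4 * of_real pi ^ 2)}"

text \<open>
  Solutions near a singular point \<open>p\<close> are multivalued; a branch is a function on a disc around
  \<open>p\<close> slit along the ray to the left of \<open>p\<close>, where the principal branches of \<open>Ln (z - p)\<close> and
  \<open>(z - p) powr a\<close> are holomorphic.
\<close>

definition slit_plane :: "complex \<Rightarrow> complex set" where
  "slit_plane p = {z. z - p \<notin> \<real>\<^sub>\<le>\<^sub>0}"

definition logarithmic_singularity :: "(complex \<Rightarrow> complex) \<Rightarrow> complex \<Rightarrow> bool" where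
  "logarithmic_singularity y p \<longleftrightarrow>
     (\<exists>a b g h. g analytic_on {p} \<and> h analytic_on {p} \<and> \<not> (\<forall>\<^sub>F z in at p. h z = 0) \<and>
        (\<forall>\<^sub>F z in at p within slit_plane p.
           y z = (z - p) powr a * g z + (z - p) powr b * h z * Ln (z - p)))"

definition apparent :: "(complex \<Rightarrow> complex) \<Rightarrow> complex \<Rightarrow> bool" where
  "apparent Q p \<longleftrightarrow>
     (\<exists>m::nat. local_exponents Q p = {1/2 + of_nat m / 2, 1/2 - of_nat m / 2}) \<and>
     (\<forall>r y. r > 0 \<and> ode_solution_on Q y (ball p r \<inter> slit_plane p)
              \<longrightarrow> \<not> logarithmic_singularity y p)"

definition q_series :: "complex \<Rightarrow> complex fps \<Rightarrow> complex \<Rightarrow> complex" where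
  "q_series s A z = q_pow s z * eval_fps A (q_pow 1 z)"

text \<open>
  \<open>A\<close> holds the coefficients \<open>1, c\<^sub>1, c\<^sub>2, \<dots>\<close> of a convergent solution
  \<open>q\<^sup>s (1 + c\<^sub>1 q + c\<^sub>2 q\<^sup>2 + \<dots>)\<close> of \<open>y'' = Q y\<close> near the cusp.
\<close>

definition normalized_solution_ii_inf ::
    "(complex \<Rightarrow> complex) \<Rightarrow> complex \<Rightarrow> complex fps \<Rightarrow> bool" where
  "normalized_solution_ii_inf Q s A \<longleftrightarrow>
     fps_nth A 0 = 1 \<and> fps_conv_radius A > 0 \<and>
     (\<exists>Y. ode_solution_on Q (q_series s A) {z. Im z > Y})"

text \<open>
  The single-valued meromorphic function on \<open>uhp\<close> obtained by analytic continuation of a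
  function \<open>f\<close> given near the cusp; by the identity theorem there is at most one.
\<close>

definition meromorphic_continuation ::
    "(complex \<Rightarrow> complex) \<Rightarrow> (complex \<Rightarrow> complex) \<Rightarrow> bool" where
  "meromorphic_continuation f G \<longleftrightarrow>
     G nicely_meromorphic_on uhp \<and> (\<forall>\<^sub>F z in at_ii_inf. G z = f z)"

end

theory Submission
  imports Defs
begin

text \<open>
  Squares of solutions of \<open>y'' = Q y\<close> satisfy the third-order linear equation
  \<open>f''' = 4 Q f' + 2 Q' f\<close>, the symmetric square, and also \<open>2 f f'' - f'\<^sup>2 = 4 Q f\<^sup>2\<close>. Apparentness
  makes every solution of the symmetric square near every point of the upper half-plane single-valued
  and meromorphic, so by gluing over rectangles every germ of a solution continues to the upper
  half-plane. There \<open>S\<close> acts on the solutions with weight \<open>-2\<close>, while \<open>T\<close> acts as \<open>-1\<close> on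
  \<open>y\<^sub>\<plusminus>\<^sup>2\<close> because \<open>n\<close> is odd.

  At \<open>p\<close> a solution has order \<open>1\<close> or \<open>1 \<plusminus> 2\<kappa>\<^sub>p\<close>, and a square has order
  \<open>1 \<plusminus> 2\<kappa>\<^sub>p\<close>. A solution fixed by \<open>S\<close> has odd order at \<open>i\<close>; as \<open>2\<kappa>\<^sub>i\<close> is odd, the order is
  \<open>1\<close>, so the solutions fixed by \<open>S\<close> form a space of dimension at most one. The images of \<open>y\<^sub>-\<^sup>2\<close>
  and \<open>y\<^sub>+\<^sup>2\<close> under \<open>1 + S\<close> are therefore proportional. That of \<open>y\<^sub>+\<^sup>2\<close> does not vanish: otherwise
  \<open>y\<^sub>+\<^sup>2\<close> would be fixed by \<open>TS\<close>, which forces its order at \<open>\<rho>\<close> to be \<open>1\<close> modulo \<open>3\<close>, whereas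
  \<open>3\<close> does not divide \<open>2\<kappa>\<^sub>\<rho>\<close>.
\<close>

subsection \<open>The indicial equation of the symmetric square\<close>

text \<open>The exponents at p differ by the integer 2 kappa_p, so without a logarithm the monodromy
  of y'' = Q y around p is the scalar 1 or -1, and quadratic expressions in the solutions do not see
  the sign. The logarithm is the only obstruction. It appears concretely as the residue of 1/u,
  where u is the square of the Frobenius solution for the larger exponent. The expression 2 f f'' -
  f'^2 - 4 Q f^2 is constant along every solution f of the symmetric square and vanishes on squares.
  At \<open>rho\<close> invariance under TS alone would allow order 1; the vanishing of this
  constant for y_+^2 is what rules that order out. The orders at the elliptic points come from
  leading terms: if psi f(phi) = f near a fixed point p of phi, then psi(p) phi'(p)^k = 1 for the
  order k of f. At i this reads -(-1)^k = 1, at \<open>rho\<close> it reads (rho^-2)^(k-1) = 1.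
  Every combination y_-^2 + c y_+^2 is antiinvariant under T, so c has only to make 1 + S annihilate
  it. Values at singular points of Q carry no information before the final normalisation, so all
  identities are first proved away from them.\<close>

lemma eventually_at_iff_punctured_ball:
  fixes p :: complex
  shows "eventually P (at p) \<longleftrightarrow> (\<exists>r>0. \<forall>z\<in>ball p r - {p}. P z)"
  unfolding eventually_at by (simp add: dist_commute Ball_def) (metis dist_commute)

lemma meromorphic_at_factorization:
  assumes "f meromorphic_on {p}" "\<not> eventually (\<lambda>z. f z = 0) (at p)"
  obtains k :: int and g where "g analytic_on {p}" "g p \<noteq> 0"
    "eventually (\<lambda>z. f z = (z - p) powi k * g z) (at p)"
proof -
  have "isolated_singularity_at f p" "not_essential f p"
    using assms(1) by (auto simp: meromorphic_at_iff)
  moreover have "\<exists>\<^sub>F w in at p. f w \<noteq> 0"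
    using assms(2) by (simp add: frequently_def)
  ultimately have *: "zor_poly f p p \<noteq> 0 \<and> (\<exists>r. r > 0 \<and> zor_poly f p holomorphic_on cball p r
     \<and> (\<forall>w\<in>cball p r - {p}. f w = zor_poly f p w * (w - p) powi zorder f p \<and> zor_poly f p w \<noteq> 0))"
    by (rule zorder_exist)
  then obtain r where r: "r > 0" "zor_poly f p holomorphic_on cball p r"
    "\<forall>w\<in>cball p r - {p}. f w = zor_poly f p w * (w - p) powi zorder f p" by blast
  show thesis
  proof (rule that[of "zor_poly f p" "zorder f p"])
    have "zor_poly f p holomorphic_on ball p r"
      using r(2) by (rule holomorphic_on_subset) auto
    then show "zor_poly f p analytic_on {p}"
      using r(1) by (auto simp: analytic_on_def)
    show "zor_poly f p p \<noteq> 0" using * by blast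
    show "eventually (\<lambda>z. f z = (z - p) powi zorder f p * zor_poly f p z) (at p)"
      unfolding eventually_at_iff_punctured_ball using r by (intro exI[of _ r]) auto
  qed
qed

lemma deriv_eqI_open:
  assumes "open D" "z \<in> D" "\<And>w. w \<in> D \<Longrightarrow> f w = g w" "(g has_field_derivative d) (at z)"
  shows "deriv f z = d"
  using assms
  by (metis DERIV_imp_deriv has_field_derivative_transform_within_open)

text \<open>The Euler operator (z - p) d/dz conjugated by (z - p)^k. It sends the holomorphic factor
  of a function of order k to the holomorphic factor of its derivative.\<close>

definition twisted_euler :: "complex \<Rightarrow> int \<Rightarrow> (complex \<Rightarrow> complex) \<Rightarrow> complex \<Rightarrow> complex" where
  "twisted_euler p k g z = of_int k * g z + (z - p) * deriv g z"

text \<open>The conclusions have the form of the hypotheses with k - 1 in place of k, so higher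
  derivatives are obtained by feeding the lemma into itself.\<close>

lemma deriv_power_int_factor:
  fixes k :: int
  assumes g: "g holomorphic_on ball p r"
    and f: "\<forall>z\<in>ball p r - {p}. f z = (z - p) powi k * g z"
  shows "twisted_euler p k g holomorphic_on ball p r"
    and "\<forall>z\<in>ball p r - {p}. deriv f z = (z - p) powi (k - 1) * twisted_euler p k g z"
proof -
  show "twisted_euler p k g holomorphic_on ball p r"
    unfolding twisted_euler_def[abs_def] by (intro holomorphic_intros holomorphic_deriv g) auto
  have "deriv f z = (z - p) powi (k - 1) * twisted_euler p k g z" if z: "z \<in> ball p r - {p}" for z
  proof -
    have "(g has_field_derivative deriv g z) (at z)"
      using g z by (meson DiffD1 holomorphic_derivI open_ball)
    then have "((\<lambda>z. (z - p) powi k * g z) has_field_derivative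
        (of_int k * (z - p) powi (k - 1) * g z + (z - p) powi k * deriv g z)) (at z)"
      using z by (auto intro!: derivative_eq_intros)
    moreover have "(z - p) powi k = (z - p) powi (k - 1) * (z - p)"
      using z power_int_add_1[of "z - p" "k - 1"] by auto
    ultimately have "((\<lambda>z. (z - p) powi k * g z) has_field_derivative (z - p) powi (k - 1) * twisted_euler p k g z) (at z)"
      by (simp add: twisted_euler_def algebra_simps)
    then show ?thesis
      using z f by (intro deriv_eqI_open[of "ball p r - {p}"]) auto
  qed
  then show "\<forall>z\<in>ball p r - {p}. deriv f z = (z - p) powi (k - 1) * twisted_euler p k g z" by blast
qed

text \<open>Powers of z - p can be cancelled only away from p. Continuity carries the resulting
  identity to p, where it compares leading coefficients.\<close>

lemma holomorphic_eq_at_centre: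
  assumes "f holomorphic_on ball p r" "g holomorphic_on ball p r" "r > 0"
    and "\<And>z. z \<in> ball p r - {p} \<Longrightarrow> f z = g z"
  shows "f p = g p"
proof -
  have "isCont (\<lambda>z. f z - g z) p"
    using assms by (intro continuous_intros continuous_on_interior[of "ball p r"]
      holomorphic_on_imp_continuous_on) auto
  then have "(\<lambda>z. f z - g z) \<midarrow>p\<rightarrow> f p - g p" by (simp add: isCont_def)
  moreover have "(\<lambda>z. f z - g z) \<midarrow>p\<rightarrow> 0"
    using assms by (intro tendsto_eventually, unfold eventually_at_iff_punctured_ball) (fastforce intro!: exI[of _ r])
  ultimately show ?thesis using LIM_unique by fastforce
qed

text \<open>The limit a may be 0, so regular points and simple poles are treated together with
  double poles.\<close>

lemma double_pole_factorization:
  assumes "Q meromorphic_on {p}" and lim: "((\<lambda>z. (z - p) ^ 2 * Q z) \<longlongrightarrow> a) (at p)"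
  obtains r B where "r > 0" "B holomorphic_on ball p r" "B p = a"
    "\<And>z. z \<in> ball p r - {p} \<Longrightarrow> Q z = (z - p) powi (-2) * B z"
proof -
  define h where "h = (\<lambda>z. (z - p) ^ 2 * Q z)"
  have h: "h meromorphic_on {p}"
    unfolding h_def by (intro meromorphic_intros assms)
  have iso: "isolated_singularity_at h p" using h meromorphic_at_iff by blast
  have "remove_sings h analytic_on {p}"
    using lim iso remove_sings_analytic_at h_def by (metis)
  then obtain r1 where r1: "r1 > 0" "remove_sings h holomorphic_on ball p r1"
    by (auto simp: analytic_on_def)
  have "eventually (\<lambda>z. remove_sings h z = h z) (at p)"
    using iso by (rule eventually_remove_sings_eq_at)
  then obtain r2 where r2: "r2 > 0" "\<And>z. z \<in> ball p r2 - {p} \<Longrightarrow> remove_sings h z = h z"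
    unfolding eventually_at_iff_punctured_ball by blast
  show thesis
  proof (rule that[of "min r1 r2" "remove_sings h"])
    show "min r1 r2 > 0" using r1 r2 by auto
    show "remove_sings h holomorphic_on ball p (min r1 r2)"
      using r1(2) by (rule holomorphic_on_subset) auto
    show "remove_sings h p = a" using lim unfolding h_def by (rule remove_sings_eqI)
    fix z assume z: "z \<in> ball p (min r1 r2) - {p}"
    then have "remove_sings h z = h z" by (intro r2(2)) auto
    then show "Q z = (z - p) powi (-2) * remove_sings h z"
      using z by (simp add: h_def power_int_minus field_simps)
  qed
qed

context
  fixes f Q :: "complex \<Rightarrow> complex" and p a :: complex and k :: int and g :: "complex \<Rightarrow> complex"
  assumes Q: "Q meromorphic_on {p}" "((\<lambda>z. (z - p) ^ 2 * Q z) \<longlongrightarrow> a) (at p)"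
    and g: "g analytic_on {p}" "g p \<noteq> 0" 
    and f: "eventually (\<lambda>z. f z = (z - p) powi k * g z) (at p)"
begin

text \<open>With a = r (r - 1) the quantity 4 a + 1 is (2 r - 1)^2. The roots are therefore the sums
  of two exponents of y'' = Q y, namely 1, 2 r and 2 (1 - r).\<close>

lemma indicial_equation:
  assumes ode: "eventually (\<lambda>z. deriv (deriv (deriv f)) z = 4 * Q z * deriv f z + 2 * deriv Q z * f z) (at p)"
  shows "(of_int k - 1) * ((of_int k - 1) ^ 2 - (4 * a + 1)) = 0"
proof -
  obtain r0 B where B: "r0 > 0" "B holomorphic_on ball p r0" "B p = a"
    "\<And>z. z \<in> ball p r0 - {p} \<Longrightarrow> Q z = (z - p) powi (-2) * B z"
    using double_pole_factorization[OF Q] by metis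
  obtain r1 where r1: "r1 > 0" "g holomorphic_on ball p r1"
    using g by (auto simp: analytic_on_def)
  obtain r2 where r2: "r2 > 0" "\<And>z. z \<in> ball p r2 - {p} \<Longrightarrow> f z = (z - p) powi k * g z"
    using f unfolding eventually_at_iff_punctured_ball by blast
  obtain r3 where r3: "r3 > 0" "\<And>z. z \<in> ball p r3 - {p} \<Longrightarrow> 
    deriv (deriv (deriv f)) z = 4 * Q z * deriv f z + 2 * deriv Q z * f z"
    using ode unfolding eventually_at_iff_punctured_ball by blast
  define r where "r = min (min r0 r1) (min r2 r3)"
  have r: "r > 0" "ball p r \<subseteq> ball p r0" "ball p r \<subseteq> ball p r1" "ball p r \<subseteq> ball p r2" "ball p r \<subseteq> ball p r3"
    using B r1 r2 r3 by (auto simp: r_def)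
  define g1 where "g1 = twisted_euler p k g"
  define g2 where "g2 = twisted_euler p (k - 1) g1"
  define g3 where "g3 = twisted_euler p (k - 2) g2"
  define B1 where "B1 = twisted_euler p (-2) B"
  have hol: "B holomorphic_on ball p r" "g holomorphic_on ball p r"
    using B(2) r1(2) r(2,3) by (auto intro: holomorphic_on_subset)
  have d0: "\<forall>z\<in>ball p r - {p}. f z = (z - p) powi k * g z" "\<forall>z\<in>ball p r - {p}. Q z = (z - p) powi (-2) * B z"
    using r2(2) B(4) r by blast+
  note d1 = deriv_power_int_factor[OF hol(2) d0(1), folded g1_def]
  note d2 = deriv_power_int_factor[OF d1, folded g2_def]
  note d3 = deriv_power_int_factor[OF d2, unfolded diff_diff_eq one_add_one, folded g3_def]
  note b1 = deriv_power_int_factor[OF hol(1) d0(2), folded B1_def]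
  \<comment> \<open>All terms of the equation carry the same power (z - p)^(k - 3), since Q and its
    derivative contribute the powers -2 and -3. Dividing by it leaves an identity of holomorphic
    factors.\<close>
  have "g3 p = 4 * B p * g1 p + 2 * B1 p * g p"
  proof (rule holomorphic_eq_at_centre[where f = g3 and g = "\<lambda>z. 4 * B z * g1 z + 2 * B1 z * g z", OF _ _ r(1)])
    show "g3 holomorphic_on ball p r" by (rule d3)
    show "(\<lambda>z. 4 * B z * g1 z + 2 * B1 z * g z) holomorphic_on ball p r"
      by (intro holomorphic_intros hol d1 b1)
    fix z assume z: "z \<in> ball p r - {p}"
    define t where "t = z - p"
    have t: "t \<noteq> 0" using z by (auto simp: t_def)
    have "deriv (deriv (deriv f)) z = 4 * Q z * deriv f z + 2 * deriv Q z * f z"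
      using z r by (intro r3(2)) auto
    then have "t powi (k - 3) * g3 z = 4 * (t powi (-2) * B z) * (t powi (k - 1) * g1 z)
      + 2 * (t powi (-3) * B1 z) * (t powi k * g z)"
      using d0[rule_format, OF z] d1(2)[rule_format, OF z] d3(2)[rule_format, OF z] b1(2)[rule_format, OF z] by (simp add: t_def)
    also have "t powi (k - 1) = t powi (k - 3) * t ^ 2"
      using t power_int_add[of t "k - 3" 2] by simp
    also have "t powi k = t powi (k - 3) * t ^ 3"
      using t power_int_add[of t "k - 3" 3] by simp
    finally have "t powi (k - 3) * g3 z = t powi (k - 3) * (4 * B z * g1 z + 2 * B1 z * g z)"
      using t by (simp add: power_int_minus field_simps)
    then show "g3 z = 4 * B z * g1 z + 2 * B1 z * g z" using t by simp
  qed
  then have "(of_int k * (of_int k - 1) * (of_int k - 2) - 4 * a * of_int k + 4 * a) * g p = 0"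
    by (simp add: twisted_euler_def g1_def g2_def g3_def B1_def B(3) algebra_simps)
  then have "of_int k * (of_int k - 1) * (of_int k - 2) - 4 * a * of_int k + 4 * a = 0"
    using g by simp
  then show ?thesis by (simp add: algebra_simps power2_eq_square)
qed

text \<open>The nonlinear equation singles out squares among the solutions of the symmetric square.
  Of the indicial roots only the doubled exponents 2 r and 2 (1 - r) survive.\<close>

lemma indicial_equation_square:
  assumes ode: "eventually (\<lambda>z. 2 * f z * deriv (deriv f) z - (deriv f z) ^ 2 = 4 * Q z * (f z) ^ 2) (at p)"
  shows "(of_int k - 1) ^ 2 = 4 * a + 1"
proof -
  obtain r0 B where B: "r0 > 0" "B holomorphic_on ball p r0" "B p = a"
    "\<And>z. z \<in> ball p r0 - {p} \<Longrightarrow> Q z = (z - p) powi (-2) * B z"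
    using double_pole_factorization[OF Q] by metis
  obtain r1 where r1: "r1 > 0" "g holomorphic_on ball p r1"
    using g by (auto simp: analytic_on_def)
  obtain r2 where r2: "r2 > 0" "\<And>z. z \<in> ball p r2 - {p} \<Longrightarrow> f z = (z - p) powi k * g z"
    using f unfolding eventually_at_iff_punctured_ball by blast
  obtain r3 where r3: "r3 > 0" "\<And>z. z \<in> ball p r3 - {p} \<Longrightarrow> 
    2 * f z * deriv (deriv f) z - (deriv f z) ^ 2 = 4 * Q z * (f z) ^ 2"
    using ode unfolding eventually_at_iff_punctured_ball by blast
  define r where "r = min (min r0 r1) (min r2 r3)"
  have r: "r > 0" "ball p r \<subseteq> ball p r0" "ball p r \<subseteq> ball p r1" "ball p r \<subseteq> ball p r2" "ball p r \<subseteq> ball p r3"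
    using B r1 r2 r3 by (auto simp: r_def)
  define g1 where "g1 = twisted_euler p k g"
  define g2 where "g2 = twisted_euler p (k - 1) g1"
  have hol: "B holomorphic_on ball p r" "g holomorphic_on ball p r"
    using B(2) r1(2) r(2,3) by (auto intro: holomorphic_on_subset)
  have d0: "\<forall>z\<in>ball p r - {p}. f z = (z - p) powi k * g z" "\<forall>z\<in>ball p r - {p}. Q z = (z - p) powi (-2) * B z"
    using r2(2) B(4) r by blast+
  note d1 = deriv_power_int_factor[OF hol(2) d0(1), folded g1_def]
  note d2 = deriv_power_int_factor[OF d1, unfolded diff_diff_eq one_add_one, folded g2_def]
  have "2 * g p * g2 p - (g1 p) ^ 2 = 4 * B p * (g p) ^ 2"
  proof (rule holomorphic_eq_at_centre[where f = "\<lambda>z. 2 * g z * g2 z - (g1 z) ^ 2"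
        and g = "\<lambda>z. 4 * B z * (g z) ^ 2", OF _ _ r(1)])
    show "(\<lambda>z. 2 * g z * g2 z - (g1 z) ^ 2) holomorphic_on ball p r"
      by (intro holomorphic_intros hol d1 d2)
    show "(\<lambda>z. 4 * B z * (g z) ^ 2) holomorphic_on ball p r"
      by (intro holomorphic_intros hol d1)
    fix z assume z: "z \<in> ball p r - {p}"
    define t where "t = z - p"
    have t: "t \<noteq> 0" using z by (auto simp: t_def)
    have "2 * f z * deriv (deriv f) z - (deriv f z) ^ 2 = 4 * Q z * (f z) ^ 2"
      using z r by (intro r3(2)) auto
    then have "2 * (t powi k * g z) * (t powi (k - 2) * g2 z) - (t powi (k - 1) * g1 z) ^ 2
       = 4 * (t powi (-2) * B z) * (t powi k * g z) ^ 2"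
      using d0[rule_format, OF z] d1(2)[rule_format, OF z] d2(2)[rule_format, OF z] by (simp add: t_def)
    also have "t powi (k - 1) = t powi (k - 2) * t"
      using t power_int_add[of t "k - 2" 1] by simp
    also have "t powi k = t powi (k - 2) * t ^ 2"
      using t power_int_add[of t "k - 2" 2] by simp
    finally have "(t powi (k - 2) * t) ^ 2 * (2 * g z * g2 z - (g1 z) ^ 2) = 
       (t powi (k - 2) * t) ^ 2 * (4 * B z * (g z) ^ 2)"
      using t by (simp add: power_int_minus field_simps power2_eq_square)
    then show "2 * g z * g2 z - (g1 z) ^ 2 = 4 * B z * (g z) ^ 2" using t by simp
  qed
  then have "(2 * of_int k * (of_int k - 1) - (of_int k) ^ 2 - 4 * a) * (g p) ^ 2 = 0"
    by (simp add: twisted_euler_def g1_def g2_def B(3) algebra_simps power2_eq_square)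
  then have "2 * of_int k * (of_int k - 1) - (of_int k) ^ 2 - 4 * a = 0"
    using g by simp
  then show ?thesis by (simp add: algebra_simps power2_eq_square)
qed

end

subsection \<open>Frobenius solutions\<close>

text \<open>One constant K serves as growth rate and as prefactor. The extra factor in
  \<open>K ^ Suc j\<close> is the one that the index shift of the Frobenius recursion
  absorbs.\<close>

lemma fps_nth_geometric_bound:
  fixes F :: "complex fps"
  assumes "fps_conv_radius F > 0"
  obtains K :: real where "K \<ge> 1" "\<And>j. norm (fps_nth F j) \<le> K ^ Suc j"
proof -
  obtain x :: real where x: "x > 0" "ereal x < fps_conv_radius F"
    using assms ereal_dense2[of 0 "fps_conv_radius F"] by auto
  have "summable (\<lambda>j. fps_nth F j * of_real x ^ j)"
    using x by (intro summable_fps) auto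
  then have "Bseq (\<lambda>j. fps_nth F j * of_real x ^ j)"
    by (intro convergent_imp_Bseq summable_imp_convergent)
  then obtain M where M: "M > 0" "\<And>j. norm (fps_nth F j * of_real x ^ j) \<le> M"
    by (auto simp: Bseq_def)
  define K where "K = max 1 (max M (1 / x))"
  have K: "K \<ge> 1" "M \<le> K" "1 / x \<le> K" by (auto simp: K_def)
  have "norm (fps_nth F j) \<le> K ^ Suc j" for j
  proof -
    have "norm (fps_nth F j) \<le> M * (1 / x) ^ j"
      using M(2)[of j] x by (simp add: norm_mult norm_power field_simps)
    also have "\<dots> \<le> K * K ^ j"
      using K x M by (intro mult_mono power_mono) auto
    finally show ?thesis by simp
  qed
  with K that show thesis by blast
qed

lemma fps_conv_radius_pos_if_geometric_bound:
  fixes G :: "complex fps"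
  assumes "K \<ge> 1" "\<And>j. norm (fps_nth G j) \<le> K ^ j"
  shows "fps_conv_radius G > 0"
proof -
  define x where "x = 1 / (2 * K)"
  have x: "x > 0" using assms by (simp add: x_def)
  have "summable (\<lambda>j. fps_nth G j * of_real x ^ j)"
  proof (rule summable_comparison_test', rule summable_geometric)
    show "norm (1 / 2 :: real) < 1" by simp
    show "norm (fps_nth G j * of_real x ^ j) \<le> (1 / 2) ^ j" for j
    proof -
      have "norm (fps_nth G j * of_real x ^ j) \<le> K ^ j * x ^ j"
        using assms x by (simp add: norm_mult norm_power mult_right_mono)
      also have "\<dots> = (1 / 2) ^ j"
        using assms by (simp add: x_def flip: power_mult_distrib)
      finally show ?thesis .
    qed
  qed
  then have "conv_radius (fps_nth G) \<ge> norm (of_real x :: complex)" by (rule conv_radius_geI)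
  with x show ?thesis unfolding fps_conv_radius_def
    by (smt (verit, best) ereal_less(2) less_le_trans norm_of_real)
qed

text \<open>For \<open>N = n = 0\<close> the division is by zero; the junk value \<open>0\<close> is a valid choice there, because
  the equation is only solved when \<open>F 0 = 0\<close> in that case.\<close>
fun frobenius_coeff :: "nat \<Rightarrow> (nat \<Rightarrow> complex) \<Rightarrow> nat \<Rightarrow> complex" where
  "frobenius_coeff N F 0 = 1"
| "frobenius_coeff N F (Suc n) =
     (\<Sum>i\<le>n. F i * frobenius_coeff N F (n - i)) / (of_nat (Suc n) * of_nat (n + N))"

text \<open>The m + 1 summands are each at most \<open>K ^ Suc m\<close>. Their number cancels
  against the factor \<open>Suc m\<close> of the denominator, and the other factor is at least 1
  unless the junk value 0 occurs.\<close>

lemma frobenius_coeff_bound: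
  assumes K: "K \<ge> 1" "\<And>j. norm (F j) \<le> K ^ Suc j"
  shows "norm (frobenius_coeff N F n) \<le> K ^ n"
proof (induction n rule: less_induct)
  case (less n)
  show ?case
  proof (cases n)
    case (Suc m)
    let ?S = "\<Sum>i\<le>m. F i * frobenius_coeff N F (m - i)"
    have "norm ?S \<le> (\<Sum>i\<le>m. K ^ Suc m)"
    proof (rule sum_norm_le)
      fix i assume i: "i \<in> {..m}"
      have "norm (F i * frobenius_coeff N F (m - i)) \<le> K ^ Suc i * K ^ (m - i)"
        unfolding norm_mult using i Suc K less.IH[of "m - i"] by (intro mult_mono) auto
      also have "\<dots> = K ^ Suc m" using i by (simp flip: power_add)
      finally show "norm (F i * frobenius_coeff N F (m - i)) \<le> K ^ Suc m" .
    qed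
    then have S: "norm ?S \<le> real (Suc m) * K ^ Suc m" by simp
    show ?thesis
    proof (cases "m + N = 0")
      case True
      then show ?thesis using Suc K by simp
    next
      case False
      have "norm (frobenius_coeff N F n) = norm ?S / (real (Suc m) * real (m + N))"
        unfolding Suc frobenius_coeff.simps norm_divide norm_mult norm_of_nat ..
      also have "\<dots> \<le> real (Suc m) * K ^ Suc m / (real (Suc m) * real (m + N))"
        using S by (rule divide_right_mono) simp
      also have "\<dots> = K ^ Suc m / real (m + N)" by simp
      also have "\<dots> \<le> K ^ Suc m / 1"
        using False K by (intro divide_left_mono) auto
      finally show ?thesis using Suc by simp
    qed
  qed simp
qed

text \<open>Substituting y = (z - p)^s g into y'' = Q y, with Q = (z - p)^(-2) (s (s - 1) + (z - p)
  \<beta>), gives this equation with N = 2 s. Since N is nonnegative, the recursion can meet a zero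
  divisor only at its first step with N = 0, where \<beta> must vanish at p.\<close>

lemma frobenius_solution:
  assumes \<beta>: "\<beta> analytic_on {p}" and N: "N = 0 \<Longrightarrow> \<beta> p = 0"
  obtains r g where "r > 0" "g holomorphic_on ball p r" "g p = 1"
    "\<And>z. z \<in> ball p r \<Longrightarrow> (z - p) * deriv (deriv g) z + of_nat N * deriv g z = \<beta> z * g z"
proof -
  define F where "F = fps_expansion \<beta> p"
  have F: "(\<lambda>w. \<beta> (p + w)) has_fps_expansion F"
    unfolding F_def using \<beta> by (rule analytic_at_imp_has_fps_expansion)
  then have radF: "fps_conv_radius F > 0" by (simp add: has_fps_expansion_def)
  have F0: "fps_nth F 0 = \<beta> p"
    by (simp add: F_def fps_expansion_def)
  define G where "G = Abs_fps (frobenius_coeff N (fps_nth F))"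
  obtain K where K: "K \<ge> 1" "\<And>j. norm (fps_nth F j) \<le> K ^ Suc j"
    using fps_nth_geometric_bound[OF radF] by blast
  have radG: "fps_conv_radius G > 0"
    using K(1) by (rule fps_conv_radius_pos_if_geometric_bound)
      (simp add: G_def frobenius_coeff_bound[OF K])
  have eq: "fps_X * fps_deriv (fps_deriv G) + of_nat N * fps_deriv G = F * G"
  proof (rule fps_ext)
    fix n
    have "fps_nth (F * G) n = (\<Sum>i\<le>n. fps_nth F i * frobenius_coeff N (fps_nth F) (n - i))"
      by (simp add: fps_mult_nth G_def atLeast0AtMost)
    also have "\<dots> = of_nat (Suc n) * of_nat (n + N) * frobenius_coeff N (fps_nth F) (Suc n)"
    proof (cases "n + N = 0")
      case True
      then show ?thesis using N F0 by simp
    next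
      case False
      then have "of_nat (Suc n) * of_nat (n + N) \<noteq> (0::complex)" 
        unfolding mult_eq_0_iff of_nat_eq_0_iff by simp
      then show ?thesis by (simp only: frobenius_coeff.simps) (simp del: of_nat_Suc of_nat_add)
    qed
    also have "\<dots> = fps_nth (fps_X * fps_deriv (fps_deriv G) + of_nat N * fps_deriv G) n"
    proof -
      have "fps_nth (of_nat N * fps_deriv G) n = of_nat N * fps_nth (fps_deriv G) n"
        by (metis fps_mult_left_const_nth fps_of_nat)
      then show ?thesis by (cases n) (simp_all add: G_def algebra_simps del: frobenius_coeff.simps(2))
    qed
    finally show "fps_nth (fps_X * fps_deriv (fps_deriv G) + of_nat N * fps_deriv G) n = fps_nth (F * G) n"
      by simp
  qed
  have "eventually (\<lambda>w. eval_fps F w = \<beta> (p + w)) (nhds 0)"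
    using F by (simp add: has_fps_expansion_def)
  then obtain d where d: "d > 0" "\<And>w. dist w 0 < d \<Longrightarrow> eval_fps F w = \<beta> (p + w)"
    unfolding eventually_nhds_metric by blast
  obtain x :: real where x: "x > 0" "ereal x < min (fps_conv_radius F) (fps_conv_radius G)"
    using radF radG ereal_dense2[of 0 "min (fps_conv_radius F) (fps_conv_radius G)"] by auto
  define r where "r = min d x"
  have r: "r > 0" "r \<le> d" "r \<le> x" using d x by (auto simp: r_def)
  have rad: "ereal (norm w) < fps_conv_radius F" "ereal (norm w) < fps_conv_radius G"
    "ereal (norm w) < fps_conv_radius (fps_deriv G)" "ereal (norm w) < fps_conv_radius (fps_deriv (fps_deriv G))"
    if "norm w < r" for w :: complex
  proof -
    have *: "ereal (norm w) < ereal x" using that r by simp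
    have "ereal x < fps_conv_radius F" "ereal x < fps_conv_radius G" using x(2) by simp_all
    note ** = less_trans[OF * this(1)] less_trans[OF * this(2)]
    show "ereal (norm w) < fps_conv_radius F" "ereal (norm w) < fps_conv_radius G" by (fact **)+
    then show "ereal (norm w) < fps_conv_radius (fps_deriv G)" 
      using fps_conv_radius_deriv[of G] by (metis less_le_trans)
    then show "ereal (norm w) < fps_conv_radius (fps_deriv (fps_deriv G))"
      using fps_conv_radius_deriv[of "fps_deriv G"] by (metis less_le_trans)
  qed
  define g where "g = (\<lambda>z. eval_fps G (z - p))"
  have d1: "(g has_field_derivative eval_fps (fps_deriv G) (z - p)) (at z)" if "z \<in> ball p r" for z
    unfolding g_def using rad(2)[of "z - p"] that
    by (auto intro!: derivative_eq_intros DERIV_chain2[OF has_field_derivative_eval_fps] simp: dist_norm norm_minus_commute)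
  have d1': "deriv g z = eval_fps (fps_deriv G) (z - p)" if "z \<in> ball p r" for z
    using d1[OF that] by (rule DERIV_imp_deriv)
  have d2: "((\<lambda>z. eval_fps (fps_deriv G) (z - p)) has_field_derivative eval_fps (fps_deriv (fps_deriv G)) (z - p)) (at z)" 
    if "z \<in> ball p r" for z
    using rad(3)[of "z - p"] that
    by (auto intro!: derivative_eq_intros DERIV_chain2[OF has_field_derivative_eval_fps] simp: dist_norm norm_minus_commute)
  have d2': "deriv (deriv g) z = eval_fps (fps_deriv (fps_deriv G)) (z - p)" if "z \<in> ball p r" for z
    by (rule deriv_eqI_open[OF open_ball that d1' d2[OF that]])
  show thesis
  proof (rule that[OF r(1), of g])
    show "g holomorphic_on ball p r" unfolding holomorphic_on_open[OF open_ball] using d1 by blast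
    show "g p = 1" by (simp add: g_def eval_fps_at_0 G_def)
    fix z assume z: "z \<in> ball p r"
    define w where "w = z - p"
    have w: "norm w < r" using z by (simp add: w_def dist_norm norm_minus_commute)
    have "eval_fps (fps_X * fps_deriv (fps_deriv G) + of_nat N * fps_deriv G) w = 
       w * eval_fps (fps_deriv (fps_deriv G)) w + of_nat N * eval_fps (fps_deriv G) w"
    proof -
      have *: "fps_conv_radius (fps_const (of_nat N) :: complex fps) = \<infinity>" by simp
      have 1: "ereal (norm w) < fps_conv_radius (fps_X * fps_deriv (fps_deriv G))"
        using fps_conv_radius_mult[of fps_X "fps_deriv (fps_deriv G)"] rad(4)[OF w] 
        by (simp add: less_le_trans)
      have 2: "ereal (norm w) < fps_conv_radius (fps_const (of_nat N) * fps_deriv G)"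
        using fps_conv_radius_mult[of "fps_const (of_nat N)" "fps_deriv G"] rad(3)[OF w] 
        by (simp add: less_le_trans)
      show ?thesis unfolding fps_of_nat[symmetric]
        using 1 2 rad[OF w] by (simp add: eval_fps_add eval_fps_mult)
    qed
    moreover have "eval_fps (F * G) w = \<beta> z * eval_fps G w"
      using d(2)[of w] w r rad[OF w] by (simp add: eval_fps_mult w_def)
    ultimately show "(z - p) * deriv (deriv g) z + of_nat N * deriv g z = \<beta> z * g z"
      using eq d1'[OF z] d2'[OF z] by (simp add: w_def g_def)
  qed
qed

subsection \<open>The symmetric square equation\<close>

definition sing :: "(complex \<Rightarrow> complex) \<Rightarrow> complex set" where
  "sing Q = {z. \<not> Q analytic_on {z}}"

text \<open>The symmetric square of \<open>y'' = Q y\<close>: products of two solutions of the latter satisfy it.\<close>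

definition sym2_at :: "(complex \<Rightarrow> complex) \<Rightarrow> (complex \<Rightarrow> complex) \<Rightarrow> complex \<Rightarrow> bool" where
  "sym2_at Q f z \<longleftrightarrow> f analytic_on {z} \<and>
     deriv (deriv (deriv f)) z = 4 * Q z * deriv f z + 2 * deriv Q z * f z"

text \<open>Values at points of \<open>sing Q\<close> are left unconstrained apart from meromorphy.
  Solutions are therefore compared only outside \<open>sing Q\<close>.\<close>

definition sym2_solution :: "(complex \<Rightarrow> complex) \<Rightarrow> complex set \<Rightarrow> (complex \<Rightarrow> complex) \<Rightarrow> bool" where
  "sym2_solution Q U f \<longleftrightarrow> f meromorphic_on U \<and> (\<forall>z\<in>U - sing Q. sym2_at Q f z)"

lemma deriv3_eqI:
  assumes "open D" "z \<in> D" "\<And>w. w \<in> D \<Longrightarrow> (f has_field_derivative f1 w) (at w)"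
    "\<And>w. w \<in> D \<Longrightarrow> (f1 has_field_derivative f2 w) (at w)"
    "\<And>w. w \<in> D \<Longrightarrow> (f2 has_field_derivative f3 w) (at w)"
  shows "f analytic_on {z}" "deriv f z = f1 z" "deriv (deriv f) z = f2 z" "deriv (deriv (deriv f)) z = f3 z"
proof -
  have 1: "deriv f w = f1 w" if "w \<in> D" for w
    using assms(3)[OF that] by (rule DERIV_imp_deriv)
  have 2: "deriv (deriv f) w = f2 w" if "w \<in> D" for w
    using assms(1) that 1 assms(4) by (intro deriv_eqI_open[of D w]) auto
  have 3: "deriv (deriv (deriv f)) w = f3 w" if "w \<in> D" for w
    using assms(1) that 2 assms(5) by (intro deriv_eqI_open[of D w]) auto
  show "deriv f z = f1 z" "deriv (deriv f) z = f2 z" "deriv (deriv (deriv f)) z = f3 z"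
    using 1 2 3 assms(2) by auto
  have "f holomorphic_on D" unfolding holomorphic_on_open[OF assms(1)] using assms(3) by blast
  then show "f analytic_on {z}" using assms(1,2) analytic_at by blast
qed

lemma holomorphic_deriv3:
  assumes "f holomorphic_on D" "open D" "z \<in> D"
  shows "(f has_field_derivative deriv f z) (at z)" 
    "(deriv f has_field_derivative deriv (deriv f) z) (at z)"
    "(deriv (deriv f) has_field_derivative deriv (deriv (deriv f)) z) (at z)"
  using assms by (auto intro!: holomorphic_derivI holomorphic_deriv)

lemma sym2_at_cong:
  assumes ev: "eventually (\<lambda>w. f w = g w) (nhds z)"
  shows "sym2_at Q f z \<longleftrightarrow> sym2_at Q g z"
    and "deriv f z = deriv g z" "deriv (deriv f) z = deriv (deriv g) z"
proof -
  have 1: "eventually (\<lambda>w. deriv f w = deriv g w) (nhds z)"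
    using ev[folded eventually_eventually[of "\<lambda>w. f w = g w" z]]
    by (rule eventually_mono) (auto intro: deriv_cong_ev)
  have 2: "eventually (\<lambda>w. deriv (deriv f) w = deriv (deriv g) w) (nhds z)"
    using 1[folded eventually_eventually[of "\<lambda>w. deriv f w = deriv g w" z]]
    by (rule eventually_mono) (auto intro: deriv_cong_ev)
  have 3: "deriv (deriv (deriv f)) z = deriv (deriv (deriv g)) z"
    using 2 by (auto intro: deriv_cong_ev)
  show "deriv f z = deriv g z" "deriv (deriv f) z = deriv (deriv g) z"
    using 1 2 by (auto dest: eventually_nhds_x_imp_x)
  then show "sym2_at Q f z \<longleftrightarrow> sym2_at Q g z"
    unfolding sym2_at_def using 3 ev analytic_at_cong[OF ev refl]
    by (auto dest: eventually_nhds_x_imp_x)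
qed

lemma sym2_at_linear_combination:
  assumes "sym2_at Q f z" "sym2_at Q g z"
  shows "sym2_at Q (\<lambda>w. a * f w + b * g w) z"
    and "deriv (\<lambda>w. a * f w + b * g w) z = a * deriv f z + b * deriv g z"
    and "deriv (deriv (\<lambda>w. a * f w + b * g w)) z = a * deriv (deriv f) z + b * deriv (deriv g) z"
proof -
  obtain D1 D2 where D: "open D1" "z \<in> D1" "f holomorphic_on D1" "open D2" "z \<in> D2" "g holomorphic_on D2"
    using assms unfolding sym2_at_def analytic_at by blast
  define D where "D = D1 \<inter> D2"
  have hol: "f holomorphic_on D" "g holomorphic_on D" "open D" "z \<in> D"
    using D by (auto simp: D_def intro: holomorphic_on_subset)
  have "((\<lambda>w. a * f w + b * g w) has_field_derivative a * deriv f w + b * deriv g w) (at w)"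
    "((\<lambda>w. a * deriv f w + b * deriv g w) has_field_derivative a * deriv (deriv f) w + b * deriv (deriv g) w) (at w)"
    "((\<lambda>w. a * deriv (deriv f) w + b * deriv (deriv g) w) has_field_derivative 
       a * deriv (deriv (deriv f)) w + b * deriv (deriv (deriv g)) w) (at w)"
    if "w \<in> D" for w
    using holomorphic_deriv3[OF hol(1,3) that] holomorphic_deriv3[OF hol(2,3) that]
    by (auto intro!: derivative_eq_intros)
  note d = deriv3_eqI[OF hol(3,4) this]
  show "sym2_at Q (\<lambda>w. a * f w + b * g w) z"
    using assms d by (simp add: sym2_at_def algebra_simps)
  show "deriv (\<lambda>w. a * f w + b * g w) z = a * deriv f z + b * deriv g z"
    "deriv (deriv (\<lambda>w. a * f w + b * g w)) z = a * deriv (deriv f) z + b * deriv (deriv g) z"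
    using d by auto
qed

lemma sym2_solution_linear_combination:
  assumes "sym2_solution Q U f" "sym2_solution Q U g"
  shows "sym2_solution Q U (\<lambda>w. a * f w + b * g w)"
  using assms unfolding sym2_solution_def
  by (auto intro!: meromorphic_intros sym2_at_linear_combination)

lemma sym2_solution_subset: "sym2_solution Q U f \<Longrightarrow> V \<subseteq> U \<Longrightarrow> sym2_solution Q V f"
  unfolding sym2_solution_def by (auto intro: meromorphic_on_subset)

text \<open>If \<open>u = y\<^sub>1\<^sup>2\<close> for a solution \<open>y\<^sub>1\<close> and \<open>h' = 1/u\<close>, then \<open>y\<^sub>1 h\<close> is a second solution.
  Working with \<open>u\<close> and \<open>h\<close> alone avoids the branches of \<open>y\<^sub>1\<close>.\<close>

lemma sym2_at_from_square:
  fixes a b c :: complex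
  assumes D: "open D" "u holomorphic_on D" "Q holomorphic_on D" "\<And>z. z \<in> D \<Longrightarrow> u z \<noteq> 0"
    and h: "\<And>z. z \<in> D \<Longrightarrow> (h has_field_derivative 1 / u z) (at z)"
    and ode: "\<And>z. z \<in> D \<Longrightarrow> 2 * u z * deriv (deriv u) z - (deriv u z) ^ 2 = 4 * Q z * (u z) ^ 2"
    and z: "z \<in> D"
  defines "f \<equiv> \<lambda>z. u z * (a + b * h z + c * (h z) ^ 2)"
  shows "sym2_at Q f z"
    and "deriv f z = deriv u z * (a + b * h z + c * (h z) ^ 2) + (b + 2 * c * h z)"
    and "deriv (deriv f) z = deriv (deriv u) z * (a + b * h z + c * (h z) ^ 2) + 
           deriv u z / u z * (b + 2 * c * h z) + 2 * c / u z"
proof -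
  define u1 u2 u3 where "u1 = deriv u" and "u2 = deriv u1" and "u3 = deriv u2"
  have du: "(u has_field_derivative u1 w) (at w)" "(u1 has_field_derivative u2 w) (at w)"
    "(u2 has_field_derivative u3 w) (at w)" if "w \<in> D" for w
    using holomorphic_deriv3[OF D(2,1) that] by (auto simp: u1_def u2_def u3_def)
  have ode': "2 * u w * u2 w - (u1 w) ^ 2 = 4 * Q w * (u w) ^ 2" if "w \<in> D" for w
    using ode[OF that] by (simp add: u1_def u2_def)
  have u3: "u3 w = 4 * Q w * u1 w + 2 * deriv Q w * u w" if w: "w \<in> D" for w
  proof -
    have dQ: "(Q has_field_derivative deriv Q w) (at w)" 
      using D(1,3) w by (auto intro: holomorphic_derivI)
    \<comment> \<open>Differentiating the quadratic equation cancels the terms with u' u'', and a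
      common factor 2 u remains to be divided out.\<close>
    have "((\<lambda>w. 2 * u w * u2 w - (u1 w) ^ 2) has_field_derivative 2 * u w * u3 w) (at w)"
      using du[OF w] by (auto intro!: derivative_eq_intros)
    then have "((\<lambda>w. 4 * Q w * (u w) ^ 2) has_field_derivative 2 * u w * u3 w) (at w)"
      by (rule has_field_derivative_transform_within_open[OF _ D(1) w]) (use ode' in auto)
    moreover have "((\<lambda>w. 4 * Q w * (u w) ^ 2) has_field_derivative 
        4 * deriv Q w * (u w) ^ 2 + 8 * Q w * u w * u1 w) (at w)"
      using du[OF w] dQ by (auto intro!: derivative_eq_intros simp: algebra_simps)
    ultimately have "2 * u w * u3 w = 4 * deriv Q w * (u w) ^ 2 + 8 * Q w * u w * u1 w"
      by (rule DERIV_unique)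
    then have "2 * u w * u3 w = 2 * u w * (4 * Q w * u1 w + 2 * deriv Q w * u w)"
      by (simp add: algebra_simps power2_eq_square)
    then show ?thesis using D(4)[OF w] by simp
  qed
  define v where "v = (\<lambda>w. 1 / u w)"
  have uv: "u w * v w = 1" if "w \<in> D" for w
    using D(4)[OF that] by (simp add: v_def)
  have dv: "(v has_field_derivative - u1 w * v w ^ 2) (at w)" if "w \<in> D" for w
    unfolding v_def using du(1)[OF that] D(4)[OF that]
    by (auto intro!: derivative_eq_intros simp: power2_eq_square)
  have dh: "(h has_field_derivative v w) (at w)" if "w \<in> D" for w
    using h[OF that] by (simp add: v_def)
  \<comment> \<open>Expressing Q through u', u'' and 1/u turns the computation of the third
    derivative into a polynomial identity.\<close>
  have Qv: "4 * Q w = 2 * u2 w * v w - (u1 w * v w) ^ 2" if w: "w \<in> D" for w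
    using ode'[OF w] D(4)[OF w] by (simp add: v_def field_simps power2_eq_square)
  define f1 where "f1 = (\<lambda>w. u1 w * (a + b * h w + c * (h w) ^ 2) + (b + 2 * c * h w))"
  define f2 where "f2 = (\<lambda>w. u2 w * (a + b * h w + c * (h w) ^ 2) + u1 w * v w * (b + 2 * c * h w) + 2 * c * v w)"
  define f3 where "f3 = (\<lambda>w. u3 w * (a + b * h w + c * (h w) ^ 2) + 4 * Q w * (b + 2 * c * h w))"
  have 1: "(f has_field_derivative f1 w) (at w)" if w: "w \<in> D" for w
  proof -
    have "(f has_field_derivative u1 w * (a + b * h w + c * (h w) ^ 2) + (u w * v w) * (b + 2 * c * h w)) (at w)"
      unfolding f_def using du[OF w] dh[OF w]
      by (auto intro!: derivative_eq_intros simp: algebra_simps)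
    then show ?thesis by (simp add: f1_def uv[OF w])
  qed
  have 2: "(f1 has_field_derivative f2 w) (at w)" if w: "w \<in> D" for w
    unfolding f1_def f2_def using du[OF w] dh[OF w]
    by (auto intro!: derivative_eq_intros simp: algebra_simps)
  have 3: "(f2 has_field_derivative f3 w) (at w)" if w: "w \<in> D" for w
    unfolding f2_def f3_def Qv[OF w] using du[OF w] dh[OF w] dv[OF w]
    by (auto intro!: derivative_eq_intros simp: algebra_simps power2_eq_square)
  note d = deriv3_eqI[OF D(1) z 1 2 3]
  show "deriv f z = deriv u z * (a + b * h z + c * (h z) ^ 2) + (b + 2 * c * h z)"
    "deriv (deriv f) z = deriv (deriv u) z * (a + b * h z + c * (h z) ^ 2) + 
           deriv u z / u z * (b + 2 * c * h z) + 2 * c / u z"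
    using d by (auto simp: f1_def f2_def u1_def u2_def v_def)
  have "f z = u z * (a + b * h z + c * (h z) ^ 2)" by (simp add: f_def)
  then have "f3 z = 4 * Q z * f1 z + 2 * deriv Q z * f z"
    by (simp add: f1_def f3_def u3[OF z] algebra_simps)
  then show "sym2_at Q f z"
    unfolding sym2_at_def using d by simp
qed

definition data_at :: "(complex \<Rightarrow> complex) \<Rightarrow> complex \<Rightarrow> complex \<times> complex \<times> complex" where
  "data_at f z = (f z, deriv f z, deriv (deriv f) z)"

text \<open>Trivial monodromy on U, stated without paths: every germ of a solution, encoded by its
  2-jet at a regular point, comes from one solution that is meromorphic on all of U.\<close>

definition all_data_extend :: "(complex \<Rightarrow> complex) \<Rightarrow> complex set \<Rightarrow> bool" where
  "all_data_extend Q U \<longleftrightarrow> (\<forall>z\<in>U - sing Q. \<forall>v. \<exists>f. sym2_solution Q U f \<and> data_at f z = v)"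

lemma data_at_from_square:
  assumes D: "open D" "u holomorphic_on D" "Q holomorphic_on D" "\<And>z. z \<in> D \<Longrightarrow> u z \<noteq> 0"
    and h: "\<And>z. z \<in> D \<Longrightarrow> (h has_field_derivative 1 / u z) (at z)"
    and ode: "\<And>z. z \<in> D \<Longrightarrow> 2 * u z * deriv (deriv u) z - (deriv u z) ^ 2 = 4 * Q z * (u z) ^ 2"
    and z: "z \<in> D"
  shows "\<exists>a b c. data_at (\<lambda>w. u w * (a + b * h w + c * (h w) ^ 2)) z = v"
proof -
  obtain v0 v1 v2 where v: "v = (v0, v1, v2)" by (cases v) auto
  have u: "u z \<noteq> 0" using D z by blast
  \<comment> \<open>If h is replaced by h - h(z), which vanishes at z, the three equations for the
    coefficients become triangular. The shift is expanded away at the end.\<close>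
  define A where "A = v0 / u z"
  define B where "B = v1 - deriv u z * A"
  define C where "C = (v2 - deriv (deriv u) z * A - deriv u z / u z * B) * u z / 2"
  have h': "((\<lambda>w. h w - h z) has_field_derivative 1 / u w) (at w)" if "w \<in> D" for w
    using h[OF that] by (auto intro!: derivative_eq_intros)
  define f where "f = (\<lambda>w. u w * (A + B * (h w - h z) + C * (h w - h z) ^ 2))"
  have "f z = v0" using u by (simp add: f_def A_def)
  moreover have "deriv f z = v1"
    using sym2_at_from_square(2)[OF D h' ode z, where a = A and b = B and c = C, folded f_def]
    by (simp add: B_def)
  moreover have "deriv (deriv f) z = v2"
    using sym2_at_from_square(3)[OF D h' ode z, where a = A and b = B and c = C, folded f_def] u
    by (simp add: C_def)
  moreover have "f = (\<lambda>w. u w * ((A - B * h z + C * (h z) ^ 2) + (B - 2 * C * h z) * h w + C * (h w) ^ 2))"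
    unfolding f_def by (rule ext) (simp add: algebra_simps power2_eq_square)
  ultimately have "data_at (\<lambda>w. u w * ((A - B * h z + C * (h z) ^ 2) + (B - 2 * C * h z) * h w + C * (h w) ^ 2)) z = v"
    by (simp add: data_at_def v)
  then show ?thesis by blast
qed

text \<open>D may omit the singular points of U. There u and h are only required to be meromorphic,
  and for h this is exactly the absence of a logarithm.\<close>

lemma all_data_extend_from_square:
  assumes D: "open D" "u holomorphic_on D" "Q holomorphic_on D" "\<And>z. z \<in> D \<Longrightarrow> u z \<noteq> 0"
    and h: "\<And>z. z \<in> D \<Longrightarrow> (h has_field_derivative 1 / u z) (at z)"
    and ode: "\<And>z. z \<in> D \<Longrightarrow> 2 * u z * deriv (deriv u) z - (deriv u z) ^ 2 = 4 * Q z * (u z) ^ 2"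
    and U: "U - sing Q \<subseteq> D" "u meromorphic_on U" "h meromorphic_on U"
  shows "all_data_extend Q U"
  unfolding all_data_extend_def
proof (intro ballI allI)
  fix z v assume z: "z \<in> U - sing Q"
  then have zD: "z \<in> D" using U by blast
  obtain a b c where "data_at (\<lambda>w. u w * (a + b * h w + c * (h w) ^ 2)) z = v"
    using data_at_from_square[OF D h ode zD, of v] by blast
  moreover have "sym2_solution Q U (\<lambda>w. u w * (a + b * h w + c * (h w) ^ 2))"
    unfolding sym2_solution_def 
    using U sym2_at_from_square(1)[OF D h ode] by (auto intro!: meromorphic_intros)
  ultimately show "\<exists>f. sym2_solution Q U f \<and> data_at f z = v" by blast
qed

subsection \<open>Uniqueness and gluing\<close>

lemma open_diff_sing:
  assumes "open U" "Q meromorphic_on U"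
  shows "open (U - sing Q)"
  using meromorphic_on_imp_sparse_singularities[OF assms(2)] unfolding sing_def
  by (rule open_diff_sparse_pts[OF assms(1)])

lemma connected_diff_sing:
  assumes "open U" "connected U" "Q meromorphic_on U"
  shows "connected (U - sing Q)"
  using assms meromorphic_on_imp_sparse_singularities[OF assms(3)] unfolding sing_def
  by (intro sparse_imp_connected) auto

lemma diff_sing_nonempty:
  assumes "open U" "U \<noteq> {}" "Q meromorphic_on U"
  shows "U - sing Q \<noteq> {}"
proof -
  obtain z where z: "z \<in> U" using assms(2) by blast
  have "eventually (\<lambda>w. w \<in> U) (at z)" 
    using assms(1) z by (rule eventually_at_in_open')
  moreover have "eventually (\<lambda>w. w \<notin> sing Q) (at z)"
    using meromorphic_on_imp_not_islimpt_singularities[OF assms(3) z]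
    by (simp add: islimpt_iff_eventually sing_def)
  ultimately have "eventually (\<lambda>w. w \<in> U - sing Q) (at z)" by eventually_elim auto
  then show ?thesis
    using eventually_happens'[OF at_neq_bot] by fast
qed

lemma eventually_not_sing:
  assumes "Q meromorphic_on {z}"
  shows "eventually (\<lambda>w. w \<notin> sing Q) (at z)"
  using meromorphic_on_imp_not_islimpt_singularities[OF assms, of z]
  by (simp add: islimpt_iff_eventually sing_def)

lemma sym2_solution_holomorphic:
  assumes "sym2_solution Q U f"
  shows "f holomorphic_on U - sing Q"
proof -
  have "f analytic_on (U - sing Q)"
    unfolding analytic_on_analytic_at[of f "U - sing Q"]
    using assms by (auto simp: sym2_solution_def sym2_at_def)
  then show ?thesis by (rule analytic_imp_holomorphic)
qed

text \<open>At a regular point the double-pole coefficient of Q is 0, so a nonzero solution has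
  order 0, 1 or 2. Vanishing of the 2-jet excludes all three.\<close>

lemma sym2_solution_zero_near:
  assumes U: "open U" "Q meromorphic_on U" "z0 \<in> U - sing Q"
    and f: "sym2_solution Q U f" "data_at f z0 = (0, 0, 0)"
  shows "eventually (\<lambda>z. f z = 0) (nhds z0)"
proof (rule ccontr)
  assume nz: "\<not> ?thesis"
  have f0: "f z0 = 0" "deriv f z0 = 0" "deriv (deriv f) z0 = 0"
    using f(2) by (auto simp: data_at_def)
  have an: "f analytic_on {z0}" using f U(3) by (auto simp: sym2_solution_def sym2_at_def)
  have Qan: "Q analytic_on {z0}" using U(3) by (auto simp: sing_def)
  have "\<not> eventually (\<lambda>z. f z = 0) (at z0)"
    using nz f0 by (auto simp: eventually_nhds_conv_at)
  then obtain k g where g: "g analytic_on {z0}" "g z0 \<noteq> 0" "eventually (\<lambda>z. f z = (z - z0) powi k * g z) (at z0)"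
    using meromorphic_at_factorization[OF analytic_on_imp_meromorphic_on[OF an]] by metis
  have "isCont (\<lambda>z. (z - z0) ^ 2 * Q z) z0"
    using analytic_at_imp_isCont[OF Qan] by (intro continuous_intros)
  then have lim: "((\<lambda>z. (z - z0) ^ 2 * Q z) \<longlongrightarrow> 0) (at z0)" by (simp add: isCont_def)
  have "eventually (\<lambda>z. z \<in> U - sing Q) (at z0)"
    using open_diff_sing[OF U(1,2)] U(3) by (rule eventually_at_in_open')
  then have "eventually (\<lambda>z. deriv (deriv (deriv f)) z = 4 * Q z * deriv f z + 2 * deriv Q z * f z) (at z0)"
    by eventually_elim (use f in \<open>auto simp: sym2_solution_def sym2_at_def\<close>)
  from indicial_equation[OF analytic_on_imp_meromorphic_on[OF Qan] lim g this]
  have "of_int ((k - 1) * ((k - 1) ^ 2 - 1)) = (0::complex)" by simp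
  then have "(k - 1) * ((k - 1) ^ 2 - 1) = 0" by (simp only: of_int_eq_0_iff)
  then have k: "k = 0 \<or> k = 1 \<or> k = 2" by (auto simp: power2_eq_1_iff)
  obtain r1 where r1: "r1 > 0" "g holomorphic_on ball z0 r1" using g(1) by (auto simp: analytic_on_def)
  obtain r2 where r2: "r2 > 0" "f holomorphic_on ball z0 r2" using an by (auto simp: analytic_on_def)
  obtain r3 where r3: "r3 > 0" "\<forall>z\<in>ball z0 r3 - {z0}. f z = (z - z0) powi k * g z"
    using g(3) unfolding eventually_at_iff_punctured_ball by blast
  define r where "r = min r1 (min r2 r3)"
  have r: "r > 0" using r1 r2 r3 by (simp add: r_def)
  have hol: "g holomorphic_on ball z0 r" "f holomorphic_on ball z0 r"
    using r1(2) r2(2) by (auto simp: r_def intro: holomorphic_on_subset)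
  have d0: "\<forall>z\<in>ball z0 r - {z0}. f z = (z - z0) powi k * g z"
    using r3(2) by (auto simp: r_def)
  note d1 = deriv_power_int_factor[OF hol(1) d0]
  note d2 = deriv_power_int_factor[OF d1]
  have hol': "deriv f holomorphic_on ball z0 r" "deriv (deriv f) holomorphic_on ball z0 r"
    using hol(2) by (auto intro: holomorphic_deriv)
  consider "k = 0" | "k = 1" | "k = 2" using k by blast
  \<comment> \<open>For order k the k-th derivative at \<open>z0\<close> is k! times the nonzero
    leading coefficient.\<close>
  then show False
  proof cases
    case 1
    then have "f z0 = g z0" using d0 by (intro holomorphic_eq_at_centre[OF hol(2,1) r]) auto
    then show False using g f0 by simp
  next
    case 2
    then have "deriv f z0 = twisted_euler z0 k g z0" 
      using d1(2) by (intro holomorphic_eq_at_centre[OF hol'(1) d1(1) r]) auto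
    then show False using g f0 2 by (simp add: twisted_euler_def)
  next
    case 3
    then have "deriv (deriv f) z0 = twisted_euler z0 (k - 1) (twisted_euler z0 k g) z0" 
      using d2(2) by (intro holomorphic_eq_at_centre[OF hol'(2) d2(1) r]) auto
    then show False using g f0 3 by (simp add: twisted_euler_def)
  qed
qed

lemma sym2_solution_unique:
  assumes U: "open U" "connected U" "Q meromorphic_on U" and z0: "z0 \<in> U - sing Q"
    and f: "sym2_solution Q U f" and g: "sym2_solution Q U g"
    and eq: "data_at f z0 = data_at g z0" and z: "z \<in> U - sing Q"
  shows "f z = g z"
proof -
  define d where "d = (\<lambda>w. 1 * f w + (-1) * g w)"
  have d: "sym2_solution Q U d" unfolding d_def using f g by (rule sym2_solution_linear_combination)
  have "sym2_at Q f z0" "sym2_at Q g z0" using f g z0 by (auto simp: sym2_solution_def)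
  note * = sym2_at_linear_combination(2,3)[OF this, of 1 "-1"]
  have "data_at d z0 = (0, 0, 0)"
    using * eq by (simp add: data_at_def d_def)
  from sym2_solution_zero_near[OF U(1,3) z0 d this]
  obtain S where S: "open S" "z0 \<in> S" "\<And>w. w \<in> S \<Longrightarrow> d w = 0" 
    unfolding eventually_nhds by blast
  have "d z = 0"
  proof (rule analytic_continuation_open[where s = "S \<inter> (U - sing Q)" and s' = "U - sing Q" and f = d and g = "\<lambda>_. 0"])
    show "d holomorphic_on U - sing Q" using d by (rule sym2_solution_holomorphic)
  qed (use S z0 z open_diff_sing[OF U(1,3)] connected_diff_sing[OF U] in auto)
  then show ?thesis by (simp add: d_def)
qed

lemma all_data_extend_subset:
  assumes "all_data_extend Q U" "V \<subseteq> U"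
  shows "all_data_extend Q V"
  using assms sym2_solution_subset unfolding all_data_extend_def by (meson Diff_iff subsetD)

lemma data_at_cong: "eventually (\<lambda>w. f w = g w) (nhds z) \<Longrightarrow> data_at f z = data_at g z"
  using sym2_at_cong(2,3)[of f g z] by (auto simp: data_at_def dest: eventually_nhds_x_imp_x)

text \<open>f and g may disagree at singular points of the overlap. These are isolated, so the glued
  function still equals g in punctured neighbourhoods, which is enough for meromorphy on V.\<close>

lemma sym2_solution_glue:
  assumes U: "open U" "open V" "Q meromorphic_on U \<union> V"
    and f: "sym2_solution Q U f" and g: "sym2_solution Q V g"
    and eq: "\<And>z. z \<in> U \<inter> V - sing Q \<Longrightarrow> f z = g z"
  defines "h \<equiv> \<lambda>z. if z \<in> U then f z else g z"
  shows "sym2_solution Q (U \<union> V) h"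
    and "\<And>z. z \<in> U - sing Q \<Longrightarrow> data_at h z = data_at f z"
    and "\<And>z. z \<in> V - sing Q \<Longrightarrow> data_at h z = data_at g z"
proof -
  have evU: "eventually (\<lambda>w. f w = h w) (nhds z)" if "z \<in> U" for z
    using eventually_nhds_in_open[OF U(1) that] by eventually_elim (auto simp: h_def)
  have evV: "eventually (\<lambda>w. g w = h w) (at z)" if "z \<in> V" for z
  proof -
    have "eventually (\<lambda>w. w \<notin> sing Q) (at z)"
      using U(3) that by (intro eventually_not_sing meromorphic_on_subset[OF U(3)]) auto
    with eventually_at_in_open'[OF U(2) that] show ?thesis
      by eventually_elim (use eq in \<open>auto simp: h_def\<close>)
  qed
  have evV': "eventually (\<lambda>w. g w = h w) (nhds z)" if "z \<in> V - sing Q" for z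
  proof -
    have "g z = h z" using that eq by (auto simp: h_def)
    with evV[of z] that show ?thesis by (simp add: eventually_nhds_conv_at)
  qed
  show "data_at h z = data_at f z" if "z \<in> U - sing Q" for z
    using data_at_cong[OF evU] that by auto
  show "data_at h z = data_at g z" if "z \<in> V - sing Q" for z
    using data_at_cong[OF evV'] that by auto
  have "h meromorphic_on U"
    using f evU by (subst meromorphic_on_cong[where g = f and B = U])
      (auto simp: sym2_solution_def eventually_nhds_conv_at eq_commute)
  moreover have "h meromorphic_on V"
    using g evV by (subst meromorphic_on_cong[where g = g and B = V])
      (auto simp: sym2_solution_def eq_commute)
  ultimately have "h meromorphic_on U \<union> V" by (rule meromorphic_on_Un)
  moreover have "sym2_at Q h z" if "z \<in> U - sing Q" for z
    using sym2_at_cong(1)[OF evU, of z] f that by (auto simp: sym2_solution_def)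
  moreover have "sym2_at Q h z" if "z \<in> V - sing Q" for z
    using sym2_at_cong(1)[OF evV', of z] g that by (auto simp: sym2_solution_def)
  ultimately show "sym2_solution Q (U \<union> V) h"
    by (auto simp: sym2_solution_def)
qed

text \<open>Connectedness of the overlap lets agreement at the single regular point
  \<open>z1\<close> spread over all of it, so that the two continuations glue.\<close>

lemma all_data_extend_Un:
  assumes U: "open U" "open V" "Q meromorphic_on U \<union> V" "connected (U \<inter> V)" "U \<inter> V \<noteq> {}"
    and good: "all_data_extend Q U" "all_data_extend Q V"
  shows "all_data_extend Q (U \<union> V)"
proof -
  have UV: "open (U \<inter> V)" using U by auto
  have Qm: "Q meromorphic_on U \<inter> V" by (rule meromorphic_on_subset[OF U(3)]) auto
  obtain z1 where z1: "z1 \<in> U \<inter> V - sing Q" using diff_sing_nonempty[OF UV U(5) Qm] by blast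
  show ?thesis
    unfolding all_data_extend_def
  proof (intro ballI allI)
    fix z v assume z: "z \<in> U \<union> V - sing Q"
    \<comment> \<open>The prescribed data may sit in either set. The partner on the other set is
      chosen by its data at \<open>z1\<close>.\<close>
    have "\<exists>f g. sym2_solution Q U f \<and> sym2_solution Q V g \<and> data_at f z1 = data_at g z1
       \<and> (z \<in> U \<and> data_at f z = v \<or> z \<in> V \<and> data_at g z = v)"
    proof (cases "z \<in> U")
      case True
      then obtain f where f: "sym2_solution Q U f" "data_at f z = v"
        using good(1) z unfolding all_data_extend_def by blast
      obtain g where g: "sym2_solution Q V g" "data_at g z1 = data_at f z1"
        using good(2) z1 unfolding all_data_extend_def by blast
      show ?thesis using f g True by metis
    next
      case False
      then have zV: "z \<in> V" using z by blast
      then obtain g where g: "sym2_solution Q V g" "data_at g z = v"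
        using good(2) z unfolding all_data_extend_def by blast
      obtain f where f: "sym2_solution Q U f" "data_at f z1 = data_at g z1"
        using good(1) z1 unfolding all_data_extend_def by blast
      show ?thesis using f g zV by metis
    qed
    then obtain f g where fg: "sym2_solution Q U f" "sym2_solution Q V g" "data_at f z1 = data_at g z1"
       "z \<in> U \<and> data_at f z = v \<or> z \<in> V \<and> data_at g z = v" by blast
    have "f w = g w" if w: "w \<in> U \<inter> V - sing Q" for w
      using sym2_solution_unique[OF UV U(4) Qm z1 _ _ fg(3) w] fg(1,2) sym2_solution_subset by blast
    note glue = sym2_solution_glue[OF U(1-3) fg(1,2) this]
    show "\<exists>f. sym2_solution Q (U \<union> V) f \<and> data_at f z = v"
      using glue fg(4) z by blast
  qed
qed

subsection \<open>Continuation to the upper half-plane\<close>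

lemma open_uhp [simp]: "open uhp"
  unfolding uhp_def by (rule open_halfspace_Im_gt)

lemma convex_uhp [simp]: "convex uhp"
  unfolding uhp_def by (rule convex_halfspace_Im_gt)

text \<open>Open rectangles are closed under intersection, so overlaps are automatically connected,
  as gluing demands.\<close>

definition rect :: "real \<Rightarrow> real \<Rightarrow> real \<Rightarrow> real \<Rightarrow> complex set" where
  "rect a b c d = {z. a < Re z \<and> Re z < b \<and> c < Im z \<and> Im z < d}"

lemma rect_eq_box: "rect a b c d = box (Complex a c) (Complex b d)"
  by (auto simp: rect_def box_complex_eq)

lemma open_rect [simp]: "open (rect a b c d)"
  by (simp add: rect_eq_box open_box)

lemma connected_rect [simp]: "connected (rect a b c d)"
  by (simp add: rect_eq_box convex_connected)

text \<open>Good refers to a closed, possibly degenerate rectangle with some open margin. The margin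
  makes adjacent rectangles overlap, and \<open>e < c\<close> keeps it inside the upper
  half-plane.\<close>

definition good_rect :: "(complex \<Rightarrow> complex) \<Rightarrow> real \<Rightarrow> real \<Rightarrow> real \<Rightarrow> real \<Rightarrow> bool" where
  "good_rect Q a b c d \<longleftrightarrow> (\<exists>e>0. e < c \<and> all_data_extend Q (rect (a - e) (b + e) (c - e) (d + e)))"

context
  fixes Q
  assumes mer: "Q meromorphic_on uhp"
    and loc: "\<And>p. p \<in> uhp \<Longrightarrow> \<exists>r>0. all_data_extend Q (ball p r)"
begin

lemma all_data_extend_rect_Un:
  assumes "all_data_extend Q R" "all_data_extend Q S"
    and "R = rect a b c d" "S = rect a' b' c' d'" "R \<inter> S \<noteq> {}" "R \<union> S \<subseteq> uhp"
  shows "all_data_extend Q (R \<union> S)"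
proof (rule all_data_extend_Un)
  have "R \<inter> S = rect (max a a') (min b b') (max c c') (min d d')"
    unfolding assms by (auto simp: rect_def)
  then show "connected (R \<inter> S)" by simp
qed (use assms meromorphic_on_subset[OF mer] in auto)

text \<open>Bisection along a horizontal segment: solvability near each point gives the local step
  and gluing the concatenation step. \<open>good_rect_all\<close> repeats this vertically with whole
  strips around segments in place of discs.\<close>

lemma good_rect_segment:
  assumes "a \<le> b" and y: "y > 0"
  shows "good_rect Q a b y y"
  using assms(1)
proof (induction rule: Bolzano)
  case (trans a b c)
  then obtain e1 e2 where e: "e1 > 0" "e1 < y" "all_data_extend Q (rect (a - e1) (b + e1) (y - e1) (y + e1))"
    "e2 > 0" "e2 < y" "all_data_extend Q (rect (b - e2) (c + e2) (y - e2) (y + e2))"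
    unfolding good_rect_def by blast
  define e where "e = min e1 e2"
  let ?R = "rect (a - e) (b + e) (y - e) (y + e)" and ?S = "rect (b - e) (c + e) (y - e) (y + e)"
  have "all_data_extend Q (?R \<union> ?S)"
  proof (rule all_data_extend_rect_Un[OF _ _ refl refl])
    show "all_data_extend Q ?R" by (rule all_data_extend_subset[OF e(3)]) (auto simp: rect_def e_def)
    show "all_data_extend Q ?S" by (rule all_data_extend_subset[OF e(6)]) (auto simp: rect_def e_def)
    have "Complex b y \<in> ?R \<inter> ?S" using e trans by (auto simp: rect_def e_def)
    then show "?R \<inter> ?S \<noteq> {}" by blast
    show "?R \<union> ?S \<subseteq> uhp" using e by (auto simp: rect_def uhp_def e_def)
  qed
  moreover have "?R \<union> ?S = rect (a - e) (c + e) (y - e) (y + e)"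
    using e trans by (auto simp: rect_def e_def)
  ultimately show ?case 
    using e unfolding good_rect_def by (intro exI[of _ e]) (auto simp: e_def)
next
  case (local x)
  have "Complex x y \<in> uhp" using y by (simp add: uhp_def)
  then obtain r where r: "r > 0" "all_data_extend Q (ball (Complex x y) r)" using loc by blast
  show ?case
  proof (intro exI[of _ "r / 4"] conjI allI impI)
    fix a b assume ab: "a \<le> x \<and> x \<le> b \<and> b - a < r / 4"
    \<comment> \<open>The horizontal deviation from x is below r/4 + r/4 and the vertical one below
      r/4, so the rectangle fits into the disc. The bound y/2 keeps it above the real axis.\<close>
    define e where "e = min (r / 4) (y / 2)"
    have e: "e \<le> r / 4" by (simp add: e_def)
    have "rect (a - e) (b + e) (y - e) (y + e) \<subseteq> ball (Complex x y) r"
    proof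
      fix z assume z: "z \<in> rect (a - e) (b + e) (y - e) (y + e)"
      have "x - Re z < r / 2" "Re z - x < r / 2" "y - Im z < r / 4" "Im z - y < r / 4"
        using z ab e by (auto simp: rect_def)
      then have "\<bar>x - Re z\<bar> < r / 2" "\<bar>y - Im z\<bar> < r / 4" by linarith+
      then have "norm (Complex x y - z) < r"
        using cmod_le[of "Complex x y - z"] unfolding minus_complex.sel complex.sel by linarith
      then show "z \<in> ball (Complex x y) r" by (simp add: dist_norm)
    qed
    then have "all_data_extend Q (rect (a - e) (b + e) (y - e) (y + e))"
      by (rule all_data_extend_subset[OF r(2)])
    then show "good_rect Q a b y y"
      unfolding good_rect_def using r y by (intro exI[of _ e]) (auto simp: e_def)
  qed (use r in auto)
qed

lemma good_rect_all:
  assumes "a \<le> b" "0 < c" "c \<le> d"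
  shows "good_rect Q a b c d"
proof -
  have "0 < c \<longrightarrow> good_rect Q a b c d"
    using assms(3)
  proof (induction rule: Bolzano)
    case (trans c d f)
    show ?case
    proof
      assume c: "0 < c"
      then obtain e1 e2 where e: "e1 > 0" "e1 < c" "all_data_extend Q (rect (a - e1) (b + e1) (c - e1) (d + e1))"
        "e2 > 0" "e2 < d" "all_data_extend Q (rect (a - e2) (b + e2) (d - e2) (f + e2))"
        using trans unfolding good_rect_def by force
      define e where "e = min e1 e2"
      let ?R = "rect (a - e) (b + e) (c - e) (d + e)" and ?S = "rect (a - e) (b + e) (d - e) (f + e)"
      have "all_data_extend Q (?R \<union> ?S)"
      proof (rule all_data_extend_rect_Un[OF _ _ refl refl])
        show "all_data_extend Q ?R" by (rule all_data_extend_subset[OF e(3)]) (auto simp: rect_def e_def)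
        show "all_data_extend Q ?S" by (rule all_data_extend_subset[OF e(6)]) (auto simp: rect_def e_def)
        have "Complex a d \<in> ?R \<inter> ?S" using e trans assms by (auto simp: rect_def e_def)
        then show "?R \<inter> ?S \<noteq> {}" by blast
        show "?R \<union> ?S \<subseteq> uhp" using e by (auto simp: rect_def uhp_def e_def)
      qed
      moreover have "?R \<union> ?S = rect (a - e) (b + e) (c - e) (f + e)"
        using e trans by (auto simp: rect_def e_def)
      ultimately show "good_rect Q a b c f"
        using e unfolding good_rect_def by (intro exI[of _ e]) (auto simp: e_def)
    qed
  next
    case (local y)
    then have y: "y > 0" using assms by simp
    obtain e where e: "e > 0" "e < y" "all_data_extend Q (rect (a - e) (b + e) (y - e) (y + e))"
      using good_rect_segment[OF assms(1) y] unfolding good_rect_def by blast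
    show ?case
    proof (intro exI[of _ "e / 2"] conjI allI impI)
      fix c d assume cd: "c \<le> y \<and> y \<le> d \<and> d - c < e / 2" and c: "0 < c"
      have "all_data_extend Q (rect (a - e / 2) (b + e / 2) (c - e / 2) (d + e / 2))"
        by (rule all_data_extend_subset[OF e(3)]) (use e cd in \<open>auto simp: rect_def\<close>)
      then show "good_rect Q a b c d"
        unfolding good_rect_def using e cd by (intro exI[of _ "e / 2"]) auto
    qed (use e in auto)
  qed
  then show ?thesis using assms by blast
qed

lemma all_data_extend_rect:
  assumes "a \<le> b" "0 < c" "c \<le> d"
  shows "all_data_extend Q (rect a b c d)"
proof -
  obtain e where "e > 0" "all_data_extend Q (rect (a - e) (b + e) (c - e) (d + e))"
    using good_rect_all[OF assms] unfolding good_rect_def by blast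
  then show ?thesis by (elim all_data_extend_subset) (auto simp: rect_def)
qed

text \<open>An exhaustion by increasing rectangles. Solutions with the same data at
  \<open>z0\<close> are forced by uniqueness to agree, so they define one function in the
  limit.\<close>

lemma all_data_extend_uhp: "all_data_extend Q uhp"
  unfolding all_data_extend_def
proof (intro ballI allI)
  fix z0 v assume z0: "z0 \<in> uhp - sing Q"
  define R where "R = (\<lambda>k::nat. rect (- real k - 1) (real k + 1) (1 / (real k + 2)) (real k + 2))"
  have mono: "R j \<subseteq> R k" if "j \<le> k" for j k
  proof -
    have "1 / (real k + 2) \<le> 1 / (real j + 2)" using that by (intro divide_left_mono) auto
    then show ?thesis using that by (auto simp: R_def rect_def)
  qed
  have R_uhp: "R k \<subseteq> uhp" for k
  proof
    fix z assume z: "z \<in> R k"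
    have "0 < 1 / (real k + 2)" by simp
    also have "\<dots> < Im z" using z by (simp add: R_def rect_def)
    finally show "z \<in> uhp" by (simp add: uhp_def)
  qed
  have cover: "\<exists>k. z \<in> R k" if z: "z \<in> uhp" for z
  proof -
    have Im: "Im z > 0" using z by (simp add: uhp_def)
    obtain k where k: "max (\<bar>Re z\<bar>) (max (Im z) (1 / Im z)) < real k" using reals_Archimedean2 by blast
    then have "1 / Im z < real k + 2" by simp
    then have "1 / (real k + 2) < Im z" using Im by (simp add: field_simps)
    then show ?thesis using k by (intro exI[of _ k]) (auto simp: R_def rect_def)
  qed
  obtain k0 where k0: "z0 \<in> R k0" using cover z0 by blast
  \<comment> \<open>The exhaustion starts late enough for every member to contain the base point
    \<open>z0\<close>.\<close>
  define S where "S = (\<lambda>k. R (k0 + k))"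
  have S: "open (S k)" "connected (S k)" "S k \<subseteq> uhp" "z0 \<in> S k" "Q meromorphic_on S k" for k
  proof -
    show "open (S k)" "connected (S k)" by (simp_all only: S_def R_def open_rect connected_rect)
    show "S k \<subseteq> uhp" unfolding S_def by (rule R_uhp)
    show "z0 \<in> S k" using mono[of k0 "k0 + k"] k0 unfolding S_def by auto
    show "Q meromorphic_on S k" unfolding S_def by (rule meromorphic_on_subset[OF mer R_uhp])
  qed
  have S_mono: "S j \<subseteq> S k" if "j \<le> k" for j k
    using that mono by (simp add: S_def)
  have S_cover: "\<exists>k. z \<in> S k" if z: "z \<in> uhp" for z
  proof -
    obtain k where "z \<in> R k" using cover[OF z] by blast
    then have "z \<in> S k" unfolding S_def using mono[of k "k0 + k"] by auto
    then show ?thesis by blast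
  qed
  have "\<exists>f. sym2_solution Q (S k) f \<and> data_at f z0 = v" for k
  proof -
    have le: "1 / (real (k0 + k) + 2) \<le> 1" using divide_le_eq_1_pos[of "real (k0 + k) + 2" 1] by linarith
    have "1 / (real (k0 + k) + 2) \<le> real (k0 + k) + 2" using le by linarith
    then have "all_data_extend Q (S k)"
      unfolding S_def R_def by (intro all_data_extend_rect divide_pos_pos) linarith+
    then show ?thesis using z0 S(4)[of k] unfolding all_data_extend_def by blast
  qed
  then obtain f where f: "\<And>k. sym2_solution Q (S k) (f k)" "\<And>k. data_at (f k) z0 = v" by metis
  have agree: "f j z = f k z" if "j \<le> k" "z \<in> S j - sing Q" for j k z
  proof (rule sym2_solution_unique[where f = "f j" and g = "f k", OF S(1,2,5)])
    show "z0 \<in> S j - sing Q" using S(4) z0 by blast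
    show "sym2_solution Q (S j) (f j)" by (rule f)
    show "sym2_solution Q (S j) (f k)" by (rule sym2_solution_subset[OF f(1) S_mono[OF that(1)]])
    show "data_at (f j) z0 = data_at (f k) z0" by (simp add: f)
  qed (rule that(2))
  \<comment> \<open>The choice of rectangle affects F only at points of \<open>sing Q\<close>, since
    the solutions agree elsewhere.\<close>
  define F where "F = (\<lambda>z. f (LEAST k. z \<in> S k) z)"
  have F: "F z = f k z" if "z \<in> S k - sing Q" for k z
  proof -
    have "(LEAST k. z \<in> S k) \<le> k" "z \<in> S (LEAST k. z \<in> S k)"
      using that by (auto intro: Least_le LeastI)
    then show ?thesis using agree that unfolding F_def by blast
  qed
  have ev: "eventually (\<lambda>w. f k w = F w) (at z)" if "z \<in> S k" for k z
  proof -
    have "eventually (\<lambda>w. w \<notin> sing Q) (at z)"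
      using that by (intro eventually_not_sing meromorphic_on_subset[OF S(5)]) auto
    with eventually_at_in_open'[OF S(1) that] show ?thesis
      by eventually_elim (use F in auto)
  qed
  have ev': "eventually (\<lambda>w. f k w = F w) (nhds z)" if "z \<in> S k - sing Q" for k z
    using ev F[OF that] that by (auto simp: eventually_nhds_conv_at)
  have "sym2_solution Q uhp F"
    unfolding sym2_solution_def
  proof (intro conjI ballI)
    show "F meromorphic_on uhp"
    proof (subst meromorphic_on_meromorphic_at, intro ballI)
      fix z assume "z \<in> uhp"
      then obtain k where k: "z \<in> S k" using S_cover by blast
      have "f k meromorphic_on {z}"
        using f(1)[of k] k by (auto simp: sym2_solution_def intro: meromorphic_on_subset)
      then show "F meromorphic_on {z}"
        using ev[OF k] by (subst meromorphic_on_cong[where g = "f k" and B = "{z}"]) (auto simp: eq_commute)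
    qed
    fix z assume z: "z \<in> uhp - sing Q"
    then obtain k where k: "z \<in> S k - sing Q" using S_cover by blast
    then show "sym2_at Q F z"
      using sym2_at_cong(1)[OF ev'[OF k]] f(1)[of k] by (auto simp: sym2_solution_def)
  qed
  moreover have "data_at F z0 = v"
    using data_at_cong[OF ev'[of z0 0]] S(4) z0 f(2) by auto
  ultimately show "\<exists>f. sym2_solution Q uhp f \<and> data_at f z0 = v" by blast
qed

end

subsection \<open>Local solvability\<close>

lemma square_of_solution:
  assumes D: "open D" "z \<in> D" "y holomorphic_on D" "\<And>w. w \<in> D \<Longrightarrow> deriv (deriv y) w = Q w * y w"
    and Q: "Q analytic_on {z}"
  shows "sym2_at Q (\<lambda>w. y w ^ 2) z"
    and "2 * y z ^ 2 * deriv (deriv (\<lambda>w. y w ^ 2)) z - (deriv (\<lambda>w. y w ^ 2) z) ^ 2 = 4 * Q z * (y z ^ 2) ^ 2"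
proof -
  obtain D1 where D1: "open D1" "z \<in> D1" "Q holomorphic_on D1"
    using Q by (auto simp: analytic_at)
  define E where "E = D \<inter> D1"
  have E: "open E" "z \<in> E" "E \<subseteq> D" "Q holomorphic_on E"
    using D D1 by (auto simp: E_def intro: holomorphic_on_subset)
  have dy: "(y has_field_derivative deriv y w) (at w)" "(deriv y has_field_derivative Q w * y w) (at w)"
    if "w \<in> E" for w
    using holomorphic_deriv3[OF D(3,1), of w] D(4)[of w] that E by auto
  have dQ: "(Q has_field_derivative deriv Q w) (at w)" if "w \<in> E" for w
    using holomorphic_derivI[OF E(4,1) that] .
  have 1: "((\<lambda>w. y w ^ 2) has_field_derivative 2 * y w * deriv y w) (at w)" if "w \<in> E" for w
    using dy[OF that] by (auto intro!: derivative_eq_intros)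
  have 2: "((\<lambda>w. 2 * y w * deriv y w) has_field_derivative 2 * (deriv y w) ^ 2 + 2 * Q w * y w ^ 2) (at w)" if "w \<in> E" for w
    using dy[OF that] by (auto intro!: derivative_eq_intros simp: algebra_simps power2_eq_square)
  have 3: "((\<lambda>w. 2 * (deriv y w) ^ 2 + 2 * Q w * y w ^ 2) has_field_derivative 
      8 * Q w * y w * deriv y w + 2 * deriv Q w * y w ^ 2) (at w)" if "w \<in> E" for w
    using dy[OF that] dQ[OF that] by (auto intro!: derivative_eq_intros simp: algebra_simps power2_eq_square)
  note d = deriv3_eqI[OF E(1,2) 1 2 3]
  show "sym2_at Q (\<lambda>w. y w ^ 2) z"
    unfolding sym2_at_def using d by (simp add: distrib_left)
  show "2 * y z ^ 2 * deriv (deriv (\<lambda>w. y w ^ 2)) z - (deriv (\<lambda>w. y w ^ 2) z) ^ 2 = 4 * Q z * (y z ^ 2) ^ 2"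
    by (simp add: d) (simp add: algebra_simps power2_eq_square power4_eq_xxxx)
qed

text \<open>For u = y^2 the quadratic equation becomes 4 y^3 (y'' - Q y) = 0. This leads back from
  squares to solutions of y'' = Q y, of which the hypothesis on logarithms speaks.\<close>

lemma square_root_solution:
  assumes D: "open D" "z \<in> D" "y holomorphic_on D" "\<And>w. w \<in> D \<Longrightarrow> u w = y w ^ 2" "\<And>w. w \<in> D \<Longrightarrow> y w \<noteq> 0"
    and ode: "2 * u z * deriv (deriv u) z - (deriv u z) ^ 2 = 4 * Q z * (u z) ^ 2"
  shows "deriv (deriv y) z = Q z * y z"
proof -
  have dy: "(y has_field_derivative deriv y w) (at w)" "(deriv y has_field_derivative deriv (deriv y) w) (at w)"
    if "w \<in> D" for w
    using holomorphic_deriv3[OF D(3,1) that] by auto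
  have 1: "((\<lambda>w. y w ^ 2) has_field_derivative 2 * y w * deriv y w) (at w)" if "w \<in> D" for w
    using dy[OF that] by (auto intro!: derivative_eq_intros)
  have 2: "((\<lambda>w. 2 * y w * deriv y w) has_field_derivative 2 * (deriv y w) ^ 2 + 2 * y w * deriv (deriv y) w) (at w)" if "w \<in> D" for w
    using dy[OF that] by (auto intro!: derivative_eq_intros simp: algebra_simps power2_eq_square)
  have d1: "deriv u w = 2 * y w * deriv y w" if "w \<in> D" for w
    using D(1) that D(4) 1[OF that] by (rule deriv_eqI_open)
  have d2: "deriv (deriv u) z = 2 * (deriv y z) ^ 2 + 2 * y z * deriv (deriv y) z"
    using D(1,2) d1 2[OF D(2)] by (rule deriv_eqI_open)
  have "4 * (y z) ^ 3 * deriv (deriv y) z = 4 * (y z) ^ 3 * (Q z * y z)"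
    using ode unfolding d2 d1[OF D(2)] D(4)[OF D(2)]
    by (simp add: algebra_simps power2_eq_square power3_eq_cube)
  then show ?thesis using D(5)[OF D(2)] by simp
qed

text \<open>Reduction of order: h' = 1/y^2 makes 2 y' h' + y h'' vanish, which leaves y'' h.\<close>

lemma second_solution:
  assumes D: "open D" "y holomorphic_on D" "\<And>w. w \<in> D \<Longrightarrow> deriv (deriv y) w = Q w * y w" "\<And>w. w \<in> D \<Longrightarrow> y w \<noteq> 0"
    and h: "\<And>w. w \<in> D \<Longrightarrow> (h has_field_derivative 1 / y w ^ 2) (at w)"
  shows "ode_solution_on Q (\<lambda>w. y w * h w) D"
proof -
  have dy: "(y has_field_derivative deriv y w) (at w)" "(deriv y has_field_derivative Q w * y w) (at w)"
    if "w \<in> D" for w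
    using holomorphic_deriv3[OF D(2,1) that] D(3)[OF that] by auto
  have 1: "((\<lambda>w. y w * h w) has_field_derivative deriv y w * h w + 1 / y w) (at w)" if "w \<in> D" for w
    using dy[OF that] h[OF that] D(4)[OF that]
    by (auto intro!: derivative_eq_intros simp: field_simps power2_eq_square)
  have 2: "((\<lambda>w. deriv y w * h w + 1 / y w) has_field_derivative Q w * (y w * h w)) (at w)" if "w \<in> D" for w
    using dy[OF that] h[OF that] D(4)[OF that]
    by (auto intro!: derivative_eq_intros simp: field_simps power2_eq_square)
  have d: "deriv (\<lambda>w. y w * h w) w = deriv y w * h w + 1 / y w" if "w \<in> D" for w
    using 1[OF that] by (rule DERIV_imp_deriv)
  show ?thesis
    unfolding ode_solution_on_def
  proof (intro conjI ballI)
    show "(\<lambda>w. y w * h w) holomorphic_on D"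
      unfolding holomorphic_on_open[OF D(1)] using 1 by blast
    show "(deriv ^^ 2) (\<lambda>w. y w * h w) w = Q w * (y w * h w)" if "w \<in> D" for w
      using deriv_eqI_open[OF D(1) that d 2[OF that]] by (simp add: numeral_2_eq_2)
  qed
qed

text \<open>Here u is the square of (z - p)^(N/2) g. The exponent N/2 may be half-integral, but u is
  single-valued. The condition on b says that N/2 solves r (r - 1) = b.\<close>

lemma frobenius_square_ode:
  fixes N :: nat
  assumes g: "g holomorphic_on ball p r" 
    "\<And>z. z \<in> ball p r \<Longrightarrow> (z - p) * deriv (deriv g) z + of_nat N * deriv g z = \<beta> z * g z"
    and Q: "\<And>z. z \<in> ball p r - {p} \<Longrightarrow> Q z = (z - p) powi (-2) * (b + (z - p) * \<beta> z)"
    and b: "4 * b = of_nat N * (of_nat N - 2)" and z: "z \<in> ball p r - {p}"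
  defines "u \<equiv> \<lambda>z. (z - p) powi int N * (g z) ^ 2"
  shows "2 * u z * deriv (deriv u) z - (deriv u z) ^ 2 = 4 * Q z * (u z) ^ 2"
proof -
  define G where "G = (\<lambda>z. (g z) ^ 2)"
  have G: "G holomorphic_on ball p r" unfolding G_def by (intro holomorphic_intros g)
  have u: "\<forall>z\<in>ball p r - {p}. u z = (z - p) powi int N * G z" by (simp add: u_def G_def)
  note d1 = deriv_power_int_factor[OF G u]
  note d2 = deriv_power_int_factor[OF d1]
  define t where "t = z - p"
  have t: "t \<noteq> 0" using z by (simp add: t_def)
  define G1 G2 where "G1 = twisted_euler p (int N) G" and "G2 = twisted_euler p (int N - 1) G1"
  have dg: "(g has_field_derivative deriv g w) (at w)" "(deriv g has_field_derivative deriv (deriv g) w) (at w)"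
    if "w \<in> ball p r" for w
    using holomorphic_deriv3[OF g(1) open_ball that] by auto
  have dG: "deriv G w = 2 * g w * deriv g w" if "w \<in> ball p r" for w
    unfolding G_def using dg[OF that] by (intro DERIV_imp_deriv) (auto intro!: derivative_eq_intros)
  have G1: "G1 w = of_nat N * g w ^ 2 + 2 * (w - p) * g w * deriv g w" if "w \<in> ball p r" for w
    by (simp add: G1_def twisted_euler_def dG[OF that]) (simp add: G_def)
  have zb: "z \<in> ball p r" using z by blast
  have "((\<lambda>w. of_nat N * g w ^ 2 + 2 * (w - p) * g w * deriv g w) has_field_derivative 
     2 * (of_nat N + 1) * g z * deriv g z + 2 * t * (deriv g z) ^ 2 + 2 * t * g z * deriv (deriv g) z) (at z)"
    using dg[OF zb] by (auto intro!: derivative_eq_intros simp: t_def algebra_simps power2_eq_square)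
  from deriv_eqI_open[OF open_ball zb G1 this]
  have dG1: "deriv G1 z = 2 * (of_nat N + 1) * g z * deriv g z + 2 * t * (deriv g z) ^ 2 + 2 * t * g z * deriv (deriv g) z" .
  have G2: "G2 z = (of_nat N - 1) * (of_nat N * g z ^ 2 + 2 * t * g z * deriv g z) + t * deriv G1 z"
    using G1[OF zb] by (simp add: G2_def twisted_euler_def t_def)
  \<comment> \<open>The terms with g'^2 cancel, and the rest is grouped so that the Frobenius
    equation for g applies.\<close>
  have "2 * G z * G2 z - (G1 z) ^ 2 = (of_nat N * (of_nat N - 2)) * g z ^ 4 
     + 4 * t * g z ^ 3 * (t * deriv (deriv g) z + of_nat N * deriv g z)"
    unfolding G2 dG1 G1[OF zb] G_def t_def[symmetric]
    by (simp add: algebra_simps power2_eq_square power3_eq_cube power4_eq_xxxx)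
  also have "t * deriv (deriv g) z + of_nat N * deriv g z = \<beta> z * g z"
    using g(2)[OF zb] by (simp add: t_def)
  also have "of_nat N * (of_nat N - 2) = 4 * b" using b by simp
  finally have main: "2 * G z * G2 z - (G1 z) ^ 2 = 4 * (b + t * \<beta> z) * G z ^ 2"
    by (simp add: G_def algebra_simps power2_eq_square power3_eq_cube power4_eq_xxxx)
  define k where "k = int N"
  define a where "a = t powi (k - 2)"
  have pw: "t powi (k - 1) = a * t" "t powi k = a * t ^ 2"
    using t power_int_add[of t "k - 2" 1] power_int_add[of t "k - 2" 2] by (auto simp: a_def)
  have "u z = a * t ^ 2 * G z" "deriv u z = a * t * G1 z" "deriv (deriv u) z = a * G2 z"
    using u[rule_format, OF z] d1(2)[rule_format, OF z] d2(2)[rule_format, OF z] pw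
    by (simp_all add: t_def G1_def G2_def k_def a_def)
  then have "2 * u z * deriv (deriv u) z - (deriv u z) ^ 2 = (a * t) ^ 2 * (2 * G z * G2 z - (G1 z) ^ 2)"
    by (simp add: algebra_simps power2_eq_square)
  also have "\<dots> = (a * t) ^ 2 * (4 * (b + t * \<beta> z) * G z ^ 2)" unfolding main ..
  also have "\<dots> = 4 * Q z * (u z) ^ 2"
    unfolding Q[OF z] \<open>u z = a * t ^ 2 * G z\<close> using t 
    by (simp add: power_int_minus field_simps power2_eq_square flip: t_def)
  finally show ?thesis .
qed

text \<open>The constant c is the residue of e / (z - p)^N at p, the only obstruction to a
  meromorphic primitive. The induction splits off the value of e at p.\<close>

lemma primitive_with_pole:
  assumes "e holomorphic_on ball p r" "r > 0"
  shows "\<exists>G c. G holomorphic_on ball p r \<and> (\<forall>z\<in>ball p r - {p}.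
     ((\<lambda>z. G z / (z - p) ^ N) has_field_derivative e z / (z - p) ^ N - c / (z - p)) (at z))"
  using assms(1)
proof (induction N arbitrary: e)
  case 0
  obtain G where G: "\<And>z. z \<in> ball p r \<Longrightarrow> (G has_field_derivative e z) (at z within ball p r)"
    using holomorphic_convex_primitive'[OF convex_ball open_ball 0] by metis
  then have G': "(G has_field_derivative e z) (at z)" if "z \<in> ball p r" for z
    using that at_within_open[OF that open_ball] by metis
  have "G holomorphic_on ball p r" unfolding holomorphic_on_open[OF open_ball] using G' by blast
  then show ?case using G' by (intro exI[of _ G] exI[of _ 0]) auto
next
  case (Suc N)
  define e1 where "e1 = (\<lambda>z. if z = p then deriv e p else (e z - e p) / (z - p))"
  have "e1 holomorphic_on ball p r"
    unfolding e1_def using Suc.prems open_ball by (rule pole_lemma_open)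
  from Suc.IH[OF this] obtain G c where G: "G holomorphic_on ball p r"
     "\<And>z. z \<in> ball p r - {p} \<Longrightarrow> ((\<lambda>z. G z / (z - p) ^ N) has_field_derivative e1 z / (z - p) ^ N - c / (z - p)) (at z)"
    by blast
  \<comment> \<open>The split-off term e(p) / (z - p)^(N + 1) adds to the residue if N = 0.
    Otherwise its primitive is -e(p) / (N (z - p)^N), which gives K. The factor z - p in H
    compensates for the raised denominator.\<close>
  define C where "C = (if N = 0 then c + e p else c)"
  define K where "K = (if N = 0 then 0 else - e p / of_nat N)"
  define H where "H = (\<lambda>z. (z - p) * (G z + K))"
  have "H holomorphic_on ball p r" unfolding H_def by (intro holomorphic_intros G)
  moreover have "((\<lambda>z. H z / (z - p) ^ Suc N) has_field_derivative e z / (z - p) ^ Suc N - C / (z - p)) (at z)"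
    if z: "z \<in> ball p r - {p}" for z
  proof -
    have t: "z - p \<noteq> 0" using z by auto
    have "((\<lambda>z. K / (z - p) ^ N) has_field_derivative - K * of_nat N / (z - p) ^ Suc N) (at z)"
    proof (cases N)
      case (Suc m)
      define t where "t = z - p"
      have "((\<lambda>z. (z - p) ^ Suc m) has_field_derivative of_nat (Suc m) * t ^ m) (at z)"
        by (rule DERIV_cong[OF DERIV_power_Suc[OF DERIV_diff[OF DERIV_ident DERIV_const]]]) (simp add: t_def)
      from DERIV_divide[OF DERIV_const this, of K]
      have "((\<lambda>z. K / (z - p) ^ Suc m) has_field_derivative
          - (K * (of_nat (Suc m) * t ^ m)) / (t ^ Suc m * t ^ Suc m)) (at z)"
        using t by (simp flip: t_def)
      also have "- (K * (of_nat (Suc m) * t ^ m)) / (t ^ Suc m * t ^ Suc m) = - K * of_nat N / t ^ Suc N"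
        using t by (simp add: Suc flip: t_def)
      finally show ?thesis by (simp add: t_def Suc)
    qed auto
    from DERIV_add[OF G(2)[OF z] this]
    have "((\<lambda>z. G z / (z - p) ^ N + K / (z - p) ^ N) has_field_derivative 
       e1 z / (z - p) ^ N - c / (z - p) - K * of_nat N / (z - p) ^ Suc N) (at z)" by simp
    also have "e1 z / (z - p) ^ N - c / (z - p) - K * of_nat N / (z - p) ^ Suc N = e z / (z - p) ^ Suc N - C / (z - p)"
    proof (cases "N = 0")
      case True
      then show ?thesis using t by (auto simp: e1_def C_def K_def field_simps)
    next
      case False
      then have "K * of_nat N = - e p" by (simp add: K_def)
      then show ?thesis using t False by (simp add: e1_def C_def diff_divide_distrib mult.commute)
    qed
    finally show ?thesis
      by (rule has_field_derivative_transform_within_open[where S = "ball p r - {p}"])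
        (use z in \<open>auto simp: H_def add_divide_distrib\<close>)
  qed
  ultimately show ?case by blast
qed

lemma open_slit_plane: "open (slit_plane p)"
proof -
  have "slit_plane p = (\<lambda>z. z - p) -` (- \<real>\<^sub>\<le>\<^sub>0)" by (auto simp: slit_plane_def)
  moreover have "open ((\<lambda>z. z - p) -` (- \<real>\<^sub>\<le>\<^sub>0))"
    by (intro open_vimage open_Compl closed_nonpos_Reals_complex continuous_intros)
  ultimately show ?thesis by simp
qed

lemma holomorphic_nonzero_near_centre:
  assumes "g holomorphic_on ball p r" "r > 0" "g p \<noteq> (0::complex)"
  obtains d where "d > 0" "\<And>z. z \<in> ball p d \<Longrightarrow> g z \<noteq> 0"
proof -
  have "continuous_on (ball p r) g" using assms(1) by (rule holomorphic_on_imp_continuous_on)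
  then have "isCont g p" using assms(2) by (simp add: continuous_on_eq_continuous_at)
  from continuous_at_avoid[OF this assms(3)] show thesis using that by auto
qed

lemma holomorphic_ball_primitive:
  assumes "f holomorphic_on ball p r"
  obtains h where "h holomorphic_on ball p r" "\<And>z. z \<in> ball p r \<Longrightarrow> (h has_field_derivative f z) (at z)"
proof -
  obtain h where h: "\<And>z. z \<in> ball p r \<Longrightarrow> (h has_field_derivative f z) (at z within ball p r)"
    using holomorphic_convex_primitive'[OF convex_ball open_ball assms] by blast
  have h': "(h has_field_derivative f z) (at z)" if "z \<in> ball p r" for z
    using h[OF that] unfolding at_within_open[OF that open_ball] .
  moreover have "h holomorphic_on ball p r" unfolding holomorphic_on_open[OF open_ball] using h' by blast
  ultimately show thesis using that by blast
qed

text \<open>A solution with value 1 at p has no zero nearby, so 1/g^2 has a holomorphic primitive on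
  a disc and no singularity arises.\<close>

lemma all_data_extend_regular:
  assumes "Q analytic_on {p}"
  shows "\<exists>r>0. all_data_extend Q (ball p r)"
proof -
  \<comment> \<open>The factor z - p gives the equation its Frobenius form for exponent 0 and
    provides the zero at p required when N = 0.\<close>
  have an: "(\<lambda>z. (z - p) * Q z) analytic_on {p}" using assms by (intro analytic_intros)
  have "(p - p) * Q p = 0" if "(0::nat) = 0" by simp
  from frobenius_solution[OF an this] obtain r1 g where g: "r1 > 0" "g holomorphic_on ball p r1" "g p = 1"
    "\<And>z. z \<in> ball p r1 \<Longrightarrow> (z - p) * deriv (deriv g) z + of_nat 0 * deriv g z = (z - p) * Q z * g z"
    by blast
  obtain r2 where r2: "r2 > 0" "Q holomorphic_on ball p r2" using assms by (auto simp: analytic_on_def)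
  have "g p \<noteq> 0" using g(3) by simp
  then obtain r3 where r3: "r3 > 0" "\<And>z. z \<in> ball p r3 \<Longrightarrow> g z \<noteq> 0"
    using holomorphic_nonzero_near_centre[OF g(2,1)] by blast
  define r where "r = min r1 (min r2 r3)"
  have r: "r > 0" "ball p r \<subseteq> ball p r1" "ball p r \<subseteq> ball p r2" "ball p r \<subseteq> ball p r3"
    using g r2 r3 by (auto simp: r_def)
  have hol: "g holomorphic_on ball p r" "Q holomorphic_on ball p r"
    using g(2) r2(2) r by (auto intro: holomorphic_on_subset)
  have nz: "g z \<noteq> 0" if "z \<in> ball p r" for z
    using that r3(2) r by blast
  have "deriv (deriv g) z = Q z * g z" if "z \<in> ball p r - {p}" for z
  proof -
    have "(z - p) * deriv (deriv g) z = (z - p) * (Q z * g z)"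
      using g(4)[of z] that r(2) by (simp add: subset_iff mult.assoc)
    then show ?thesis using that by simp
  qed
  moreover have "deriv (deriv g) p = Q p * g p"
  proof (rule holomorphic_eq_at_centre[where f = "deriv (deriv g)" and g = "\<lambda>z. Q z * g z" and r = r])
    show "deriv (deriv g) holomorphic_on ball p r"
      by (intro holomorphic_deriv hol open_ball)
    show "(\<lambda>z. Q z * g z) holomorphic_on ball p r"
      by (intro holomorphic_intros hol)
  qed (fact r calculation)+
  ultimately have ode: "deriv (deriv g) z = Q z * g z" if "z \<in> ball p r" for z
    using that by (cases "z = p") auto
  have Qan: "Q analytic_on {z}" if "z \<in> ball p r" for z
    using hol(2) that analytic_at by blast
  have u: "(\<lambda>z. g z ^ 2) holomorphic_on ball p r" by (intro holomorphic_intros hol)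
  have "(\<lambda>z. 1 / g z ^ 2) holomorphic_on ball p r"
    using nz by (intro holomorphic_intros hol) auto
  from holomorphic_ball_primitive[OF this]
  obtain h where h: "h holomorphic_on ball p r"
    "\<And>z. z \<in> ball p r \<Longrightarrow> (h has_field_derivative 1 / g z ^ 2) (at z)" by blast
  have "all_data_extend Q (ball p r)"
  proof (rule all_data_extend_from_square[OF open_ball u hol(2) _ h(2)])
    show "2 * g z ^ 2 * deriv (deriv (\<lambda>z. g z ^ 2)) z - (deriv (\<lambda>z. g z ^ 2) z) ^ 2 = 4 * Q z * (g z ^ 2) ^ 2"
      if "z \<in> ball p r" for z
      using square_of_solution(2)[OF open_ball that hol(1) ode Qan[OF that]] by blast
    show "(\<lambda>z. g z ^ 2) meromorphic_on ball p r" "h meromorphic_on ball p r"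
      using u h(1) by (auto intro!: analytic_on_imp_meromorphic_on simp: analytic_on_open)
  qed (use nz in auto)
  then show ?thesis using r by blast
qed

text \<open>Apparentness is used to annihilate the residue of 1/u for the square u of the solution
  with the larger exponent. Then 1/u has a meromorphic primitive. Since p is singular, data are
  prescribed only where u has no zero.\<close>

lemma all_data_extend_singular:
  fixes m :: nat
  assumes Q: "Q meromorphic_on {p}" "p \<in> sing Q" 
    and lim: "((\<lambda>z. (z - p) ^ 2 * Q z) \<longlongrightarrow> (of_nat m ^ 2 - 1) / 4) (at p)"
    and m: "m \<ge> 1" and no_log: "\<And>r y. r > 0 \<Longrightarrow> ode_solution_on Q y (ball p r \<inter> slit_plane p)
              \<Longrightarrow> \<not> logarithmic_singularity y p"
  shows "\<exists>r>0. all_data_extend Q (ball p r)"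
proof -
  define b where "b = (of_nat m ^ 2 - 1 :: complex) / 4"
  \<comment> \<open>Twice the larger exponent (1 + m)/2, hence the order of u at p.\<close>
  define N where "N = m + 1"
  have b: "4 * b = of_nat N * (of_nat N - 2)"
    by (simp add: b_def N_def field_simps power2_eq_square)
  obtain r0 B where B: "r0 > 0" "B holomorphic_on ball p r0" "B p = b"
    "\<And>z. z \<in> ball p r0 - {p} \<Longrightarrow> Q z = (z - p) powi (-2) * B z"
    using double_pole_factorization[OF Q(1) lim] b_def by metis
  define \<beta> where "\<beta> = (\<lambda>z. if z = p then deriv B p else (B z - B p) / (z - p))"
  have \<beta>: "\<beta> holomorphic_on ball p r0"
    unfolding \<beta>_def using B(2) open_ball by (rule pole_lemma_open)
  then have an: "\<beta> analytic_on {p}" using B(1) by (auto simp: analytic_on_def)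
  have "\<beta> p = 0" if "N = 0" using that by (simp add: N_def)
  from frobenius_solution[OF an this] obtain r1 g where g: "r1 > 0" "g holomorphic_on ball p r1" "g p = 1"
    "\<And>z. z \<in> ball p r1 \<Longrightarrow> (z - p) * deriv (deriv g) z + of_nat N * deriv g z = \<beta> z * g z"
    by blast
  have "g p \<noteq> 0" using g(3) by simp
  then obtain r3 where r3: "r3 > 0" "\<And>z. z \<in> ball p r3 \<Longrightarrow> g z \<noteq> 0"
    using holomorphic_nonzero_near_centre[OF g(2,1)] by blast
  define r where "r = min r1 (min r0 r3)"
  have r: "r > 0" "ball p r \<subseteq> ball p r1" "ball p r \<subseteq> ball p r0" "ball p r \<subseteq> ball p r3"
    using g B r3 by (auto simp: r_def)
  have hol: "g holomorphic_on ball p r" using g(2) r by (auto intro: holomorphic_on_subset)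
  have nz: "g z \<noteq> 0" if "z \<in> ball p r" for z
    using that r3(2) r by blast
  define D where "D = ball p r - {p}"
  have D: "open D" by (auto simp: D_def)
  have QD: "Q z = (z - p) powi (-2) * (b + (z - p) * \<beta> z)" if "z \<in> ball p r - {p}" for z
  proof -
    have "Q z = (z - p) powi (-2) * B z" using B(4) that r(3) by blast
    moreover have "B z = b + (z - p) * \<beta> z" using that B(3) by (simp add: \<beta>_def)
    ultimately show ?thesis by simp
  qed
  have "(\<lambda>z. (z - p) powi (-2) * B z) holomorphic_on D"
    using r(3) by (intro holomorphic_intros holomorphic_on_subset[OF B(2)]) (auto simp: D_def)
  then have Qhol: "Q holomorphic_on D"
  proof (rule holomorphic_transform)
    show "(z - p) powi (-2) * B z = Q z" if "z \<in> D" for z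
      using B(4)[of z] that r(3) unfolding D_def by auto
  qed
  define u where "u = (\<lambda>z. (z - p) powi int N * (g z) ^ 2)"
  have u: "u holomorphic_on D" unfolding u_def
    by (intro holomorphic_intros holomorphic_on_subset[OF hol]) (auto simp: D_def)
  have u_nz: "u z \<noteq> 0" if "z \<in> D" for z
    using nz that by (auto simp: u_def D_def)
  have ode: "2 * u z * deriv (deriv u) z - (deriv u z) ^ 2 = 4 * Q z * (u z) ^ 2" if "z \<in> D" for z
    unfolding u_def
  proof (rule frobenius_square_ode[OF hol _ QD b])
    show "z \<in> ball p r - {p}" using that by (simp add: D_def)
    show "(z - p) * deriv (deriv g) z + of_nat N * deriv g z = \<beta> z * g z" if "z \<in> ball p r" for z
      using g(4) that r(2) by blast
  qed
  define e where "e = (\<lambda>z. 1 / g z ^ 2)"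
  have "e holomorphic_on ball p r" unfolding e_def using nz by (intro holomorphic_intros hol) auto
  from primitive_with_pole[OF this r(1), of N] obtain G c where G: "G holomorphic_on ball p r"
    and dG: "\<And>z. z \<in> D \<Longrightarrow> ((\<lambda>z. G z / (z - p) ^ N) has_field_derivative e z / (z - p) ^ N - c / (z - p)) (at z)"
    unfolding D_def by blast
  have eu: "e z / (z - p) ^ N = 1 / u z" for z
    by (simp add: e_def u_def)
  \<comment> \<open>If c were nonzero, a primitive of 1/u on the slit disc would contain c Ln (z -
    p). Multiplying it by the square root of u gives a solution with a genuine logarithm.\<close>
  have "c = 0"
  proof (rule ccontr)
    assume c: "c \<noteq> 0"
    define s where "s = (of_nat N / 2 :: complex)"
    define W where "W = ball p r \<inter> slit_plane p"
    have W: "open W" "W \<subseteq> D" "W \<subseteq> ball p r"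
      using open_slit_plane by (auto simp: W_def D_def slit_plane_def)
    have W_slit: "z - p \<notin> \<real>\<^sub>\<le>\<^sub>0" if "z \<in> W" for z using that by (simp add: W_def slit_plane_def)
    define y1 where "y1 = (\<lambda>z. (z - p) powr s * g z)"
    have y1: "y1 holomorphic_on W"
      unfolding y1_def by (intro holomorphic_intros holomorphic_on_subset[OF hol] W) (use W_slit in auto)
    have y1_sq: "u z = y1 z ^ 2" if "z \<in> W" for z
    proof -
      have "z - p \<noteq> 0" using W_slit[OF that] by auto
      moreover have "(z - p) powr s * (z - p) powr s = (z - p) powr of_nat N"
        by (simp add: s_def flip: powr_add)
      ultimately show ?thesis
        by (simp add: u_def y1_def power2_eq_square powr_nat)
    qed
    have y1_nz: "y1 z \<noteq> 0" if "z \<in> W" for z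
      using u_nz[of z] y1_sq[OF that] that W by auto
    have y1_ode: "deriv (deriv y1) z = Q z * y1 z" if "z \<in> W" for z
    proof (rule square_root_solution[where u = u and D = W])
      show "2 * u z * deriv (deriv u) z - (deriv u z) ^ 2 = 4 * Q z * (u z) ^ 2"
        using that W(2) by (intro ode) blast
    qed (fact W that y1 y1_sq y1_nz)+
    define h where "h = (\<lambda>z. G z / (z - p) ^ N + c * Ln (z - p))"
    have "(h has_field_derivative 1 / y1 z ^ 2) (at z)" if "z \<in> W" for z
    proof -
      have "((\<lambda>z. c * Ln (z - p)) has_field_derivative c / (z - p)) (at z)"
        using W_slit[OF that] by (auto intro!: derivative_eq_intros simp: divide_inverse mult.commute)
      from DERIV_add[OF dG[OF subsetD[OF W(2) that]] this] show ?thesis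
        using y1_sq[OF that] by (simp add: h_def[abs_def] eu)
    qed
    from second_solution[OF W(1) y1 y1_ode y1_nz this]
    have "\<not> logarithmic_singularity (\<lambda>z. y1 z * h z) p"
      using no_log[OF r(1)] by (simp add: W_def)
    moreover have "logarithmic_singularity (\<lambda>z. y1 z * h z) p"
      unfolding logarithmic_singularity_def
    proof (intro exI conjI)
      \<comment> \<open>The witnesses come from expanding \<open>y1 z * h z\<close>: the pole of the
        primitive lowers the exponent s by N, and the logarithm has coefficient
        \<open>c * g z\<close>, nonzero near p.\<close>
      show "(\<lambda>z. g z * G z) analytic_on {p}"
        using hol G r(1) by (intro analytic_intros) (auto simp: analytic_on_def)
      show "(\<lambda>z. c * g z) analytic_on {p}"
        using hol r(1) by (intro analytic_intros) (auto simp: analytic_on_def)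
      show "\<not> (\<forall>\<^sub>F z in at p. c * g z = 0)"
      proof
        assume "\<forall>\<^sub>F z in at p. c * g z = 0"
        moreover have "\<forall>\<^sub>F z in at p. c * g z \<noteq> 0"
          unfolding eventually_at_iff_punctured_ball using r(1) nz c by (intro exI[of _ r]) auto
        ultimately have "\<forall>\<^sub>F z in at p. False" by eventually_elim auto
        then show False by simp
      qed
      show "\<forall>\<^sub>F z in at p within slit_plane p. y1 z * h z = 
          (z - p) powr (s - of_nat N) * (g z * G z) + (z - p) powr s * (c * g z) * Ln (z - p)"
        unfolding eventually_at_filter
      proof (intro always_eventually allI impI)
        fix z assume "z \<noteq> p" "z \<in> slit_plane p"
        then have "(z - p) powr (s - of_nat N) = (z - p) powr s / (z - p) ^ N"
          by (simp add: powr_diff powr_nat)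
        then show "y1 z * h z = (z - p) powr (s - of_nat N) * (g z * G z) + (z - p) powr s * (c * g z) * Ln (z - p)"
          by (simp add: y1_def h_def distrib_left distrib_right)
      qed
    qed
    ultimately show False by blast
  qed
  then have h: "((\<lambda>z. G z / (z - p) ^ N) has_field_derivative 1 / u z) (at z)" if "z \<in> D" for z
    using dG[OF that] by (simp add: eu)
  have "all_data_extend Q (ball p r)"
  proof (rule all_data_extend_from_square[OF D u Qhol u_nz h ode])
    have "g meromorphic_on ball p r" "G meromorphic_on ball p r"
      using hol G by (auto intro!: analytic_on_imp_meromorphic_on simp: analytic_on_open)
    then show "u meromorphic_on ball p r" "(\<lambda>z. G z / (z - p) ^ N) meromorphic_on ball p r"
      unfolding u_def by (auto intro!: meromorphic_intros)
    show "ball p r - sing Q \<subseteq> D" using Q(2) by (auto simp: D_def)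
  qed auto
  then show ?thesis using r by blast
qed

subsection \<open>The action of the modular group\<close>

lemma in_uhp_inverse: "z \<in> uhp \<Longrightarrow> - 1 / z \<in> uhp"
proof -
  assume "z \<in> uhp"
  then have "Im z > 0" by (simp add: uhp_def)
  moreover from this have "z \<noteq> 0" by auto
  ultimately show "- 1 / z \<in> uhp"
    by (simp add: uhp_def Im_divide divide_simps sum_power2_gt_zero_iff complex_eq_iff)
qed

lemma uhp_nonzero: "z \<in> uhp \<Longrightarrow> z \<noteq> 0"
  by (auto simp: uhp_def)

lemma in_uhp_shift: "z \<in> uhp \<Longrightarrow> z + 1 \<in> uhp"
  by (simp add: uhp_def)

text \<open>The action \<open>slash (-2) f S_mat\<close> with the Moebius map and the integer power
  written out.\<close>

definition slash_S :: "(complex \<Rightarrow> complex) \<Rightarrow> complex \<Rightarrow> complex" where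
  "slash_S f z = z ^ 2 * f (- 1 / z)"

lemma slash_S_slash_S: "z \<in> uhp \<Longrightarrow> slash_S (slash_S f) z = f z"
  using uhp_nonzero[of z] by (simp add: slash_S_def power_divide)

lemma analytic_inverse_uhp: "z \<in> uhp \<Longrightarrow> (\<lambda>z. - 1 / z) analytic_on {z}"
  using uhp_nonzero[of z] by (intro analytic_intros) auto

lemma slash_S_meromorphic:
  assumes "f meromorphic_on uhp"
  shows "slash_S f meromorphic_on uhp"
proof -
  have "(\<lambda>z. f (- 1 / z)) meromorphic_on uhp"
  proof (rule meromorphic_on_compose[OF assms])
    show "(\<lambda>z. - 1 / z) analytic_on uhp"
      using uhp_nonzero by (intro analytic_intros) auto
    show "(\<lambda>z. - 1 / z) ` uhp \<subseteq> uhp" using in_uhp_inverse by blast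
  qed
  then show ?thesis unfolding slash_S_def[abs_def] by (intro meromorphic_intros)
qed

context
  fixes Q :: "complex \<Rightarrow> complex"
  assumes QS: "\<And>z. z \<in> uhp \<Longrightarrow> Q (- 1 / z) = z ^ 4 * Q z"
begin

lemma weight_four_inverse_sing:
  assumes z: "z \<in> uhp - sing Q"
  shows "- 1 / z \<in> uhp - sing Q"
proof -
  define w where "w = - 1 / z"
  have w: "w \<in> uhp" "- 1 / w = z" using z in_uhp_inverse uhp_nonzero by (auto simp: w_def)
  have "Q analytic_on {- 1 / w}" using z w by (simp add: sing_def)
  with analytic_inverse_uhp[OF w(1)] have "(\<lambda>w. Q (- 1 / w)) analytic_on {w}"
    using analytic_on_compose_gen[of "\<lambda>w. - 1 / w" "{w}" Q "{- 1 / w}"] by (auto simp: o_def)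
  then have "(\<lambda>w. Q (- 1 / w) * (- 1 / w) ^ 4) analytic_on {w}"
    by (intro analytic_intros analytic_inverse_uhp[OF w(1)])
  also have "?this \<longleftrightarrow> Q analytic_on {w}"
  proof (rule analytic_at_cong[OF _ refl])
    show "eventually (\<lambda>x. Q (- 1 / x) * (- 1 / x) ^ 4 = Q x) (nhds w)"
      using eventually_nhds_in_open[OF open_uhp w(1)]
    proof eventually_elim
      case (elim x)
      then show ?case using QS[OF elim] uhp_nonzero[OF elim] by (simp add: power_divide)
    qed
  qed
  finally show ?thesis using w by (simp add: sing_def w_def)
qed

text \<open>Bol's identity: the third derivative intertwines the weights \<open>-2\<close> and \<open>4\<close>.\<close>

lemma sym2_at_slash_S:
  assumes z: "z \<in> uhp - sing Q" and f: "sym2_at Q f (- 1 / z)"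
  shows "sym2_at Q (slash_S f) z"
proof -
  define s where "s = (\<lambda>z::complex. - 1 / z)"
  have sz: "s z \<in> uhp - sing Q" unfolding s_def by (rule weight_four_inverse_sing[OF z])
  obtain D1 where D1: "open D1" "s z \<in> D1" "f holomorphic_on D1"
    using f unfolding sym2_at_def analytic_at s_def by blast
  obtain D2 where D2: "open D2" "s z \<in> D2" "Q holomorphic_on D2"
    using sz unfolding sing_def analytic_at by blast
  have Qz: "Q analytic_on {z}" using z by (simp add: sing_def)
  define D where "D = s -` (D1 \<inter> D2) \<inter> uhp"
  have "continuous_on uhp s"
    unfolding s_def using uhp_nonzero by (intro continuous_intros) auto
  then have D: "open D" unfolding D_def using D1 D2
    by (metis continuous_on_open_vimage open_Int open_uhp)
  have zD: "z \<in> D" using D1 D2 z by (auto simp: D_def)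
  have nz: "w \<noteq> 0" if "w \<in> D" for w using that uhp_nonzero by (auto simp: D_def)
  have ds: "(s has_field_derivative 1 / w ^ 2) (at w)" if "w \<in> D" for w
    unfolding s_def using nz[OF that] by (auto intro!: derivative_eq_intros simp: power2_eq_square)
  have comp: "((\<lambda>w. g (s w)) has_field_derivative g' / w ^ 2) (at w)"
    if "(g has_field_derivative g') (at (s w))" "w \<in> D" for g g' w
    using DERIV_chain2[OF that(1) ds[OF that(2)]] by simp
  have df: "((\<lambda>w. f (s w)) has_field_derivative deriv f (s w) / w ^ 2) (at w)"
    "((\<lambda>w. deriv f (s w)) has_field_derivative deriv (deriv f) (s w) / w ^ 2) (at w)"
    "((\<lambda>w. deriv (deriv f) (s w)) has_field_derivative deriv (deriv (deriv f)) (s w) / w ^ 2) (at w)"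
    if "w \<in> D" for w
    using comp[OF holomorphic_deriv3(1)[OF D1(3,1)] that] comp[OF holomorphic_deriv3(2)[OF D1(3,1)] that] 
      comp[OF holomorphic_deriv3(3)[OF D1(3,1)] that] that by (auto simp: D_def)
  have 1: "(slash_S f has_field_derivative 2 * w * f (s w) + deriv f (s w)) (at w)" if "w \<in> D" for w
  proof -
    have "((\<lambda>w. w ^ 2 * f (s w)) has_field_derivative 
        2 * w * f (s w) + w ^ 2 * (deriv f (s w) / w ^ 2)) (at w)"
      using df(1)[OF that] by (auto intro!: derivative_eq_intros)
    then show ?thesis using nz[OF that] by (simp add: slash_S_def[abs_def] s_def)
  qed
  have 2: "((\<lambda>w. 2 * w * f (s w) + deriv f (s w)) has_field_derivative 
      2 * f (s w) + 2 * deriv f (s w) / w + deriv (deriv f) (s w) / w ^ 2) (at w)" if "w \<in> D" for w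
    using df[OF that] nz[OF that] by (auto intro!: derivative_eq_intros simp: power2_eq_square)
  \<comment> \<open>The terms with f' and f'' cancel here, as happens for the third derivative in
    weight -2.\<close>
  have 3: "((\<lambda>w. 2 * f (s w) + 2 * deriv f (s w) / w + deriv (deriv f) (s w) / w ^ 2) has_field_derivative
      deriv (deriv (deriv f)) (s w) / w ^ 4) (at w)" if "w \<in> D" for w
  proof -
    have "((\<lambda>w. 2 * f (s w) + 2 * deriv f (s w) / w + deriv (deriv f) (s w) / w ^ 2) has_field_derivative
      2 * (deriv f (s w) / w ^ 2) + (2 * (deriv (deriv f) (s w) / w ^ 2) * w - 2 * deriv f (s w) * 1) / (w * w) +
      (deriv (deriv (deriv f)) (s w) / w ^ 2 * w ^ 2 - deriv (deriv f) (s w) * (2 * w)) / (w ^ 2 * w ^ 2)) (at w)"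
      using df[OF that] nz[OF that] by (auto intro!: derivative_eq_intros simp: mult_ac)
    also have "2 * (deriv f (s w) / w ^ 2) + (2 * (deriv (deriv f) (s w) / w ^ 2) * w - 2 * deriv f (s w) * 1) / (w * w) +
      (deriv (deriv (deriv f)) (s w) / w ^ 2 * w ^ 2 - deriv (deriv f) (s w) * (2 * w)) / (w ^ 2 * w ^ 2) = 
      deriv (deriv (deriv f)) (s w) / w ^ 4"
      using nz[OF that] by (simp add: field_simps power2_eq_square power4_eq_xxxx)
    finally show ?thesis .
  qed
  note d = deriv3_eqI[OF D zD 1 2 3]
  have z0: "z \<noteq> 0" using nz zD by blast
  have Qs: "Q (s z) = z ^ 4 * Q z" using QS z by (simp add: s_def)
  \<comment> \<open>The term with \<open>z ^ 5\<close> measures the failure of Q' to be modular. It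
    matches the term \<open>2 * w * f (s w)\<close> in the first derivative of
    \<open>slash_S f\<close>.\<close>
  have Q's: "deriv Q (s z) = 4 * z ^ 5 * Q z + z ^ 6 * deriv Q z"
  proof -
    have "(Q has_field_derivative deriv Q z) (at z)"
      using Qz analytic_on_imp_differentiable_at field_differentiable_derivI by blast
    then have a: "((\<lambda>w. w ^ 4 * Q w) has_field_derivative 4 * z ^ 3 * Q z + z ^ 4 * deriv Q z) (at z)"
      by (auto intro!: derivative_eq_intros)
    have b: "((\<lambda>w. Q (s w)) has_field_derivative deriv Q (s z) / z ^ 2) (at z)"
      using comp[OF holomorphic_derivI[OF D2(3,1,2)] zD] .
    have "((\<lambda>w. w ^ 4 * Q w) has_field_derivative deriv Q (s z) / z ^ 2) (at z)"
      using b D zD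
    proof (rule has_field_derivative_transform_within_open)
      show "Q (s w) = w ^ 4 * Q w" if "w \<in> D" for w
        using QS[of w] that unfolding s_def D_def by blast
    qed
    from DERIV_unique[OF this a] have "deriv Q (s z) = z ^ 2 * (4 * z ^ 3 * Q z + z ^ 4 * deriv Q z)"
      using z0 by (simp add: field_simps)
    then show ?thesis by (simp add: algebra_simps flip: power_add)
  qed
  have "deriv (deriv (deriv f)) (s z) = 4 * Q (s z) * deriv f (s z) + 2 * deriv Q (s z) * f (s z)"
    using f by (simp add: sym2_at_def s_def)
  also have "\<dots> = z ^ 4 * (4 * Q z * deriv f (s z) + 2 * (4 * z * Q z + z ^ 2 * deriv Q z) * f (s z))"
    unfolding Qs Q's by (simp add: algebra_simps power2_eq_square numeral_eq_Suc)
  finally have "deriv (deriv (deriv f)) (s z) / z ^ 4 = 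
      4 * Q z * deriv f (s z) + 2 * (4 * z * Q z + z ^ 2 * deriv Q z) * f (s z)"
    using z0 by simp
  moreover have "slash_S f z = z ^ 2 * f (s z)" by (simp add: slash_S_def s_def)
  ultimately show ?thesis
    unfolding sym2_at_def using d by (simp add: algebra_simps)
qed

lemma sym2_solution_slash_S:
  assumes "sym2_solution Q uhp f"
  shows "sym2_solution Q uhp (slash_S f)"
  using assms slash_S_meromorphic sym2_at_slash_S weight_four_inverse_sing
  unfolding sym2_solution_def by blast

end

text \<open>Near p the map \<phi> acts as multiplication of z - p by \<mu>, so the leading term of f
  of order k is multiplied by \<psi>(p) \<mu>^k. Equality with f forces this number to be 1.\<close>

lemma fixed_point_multiplier:
  assumes f: "eventually (\<lambda>z. f z = (z - p) powi k * g z) (at p)" and g: "g analytic_on {p}" "g p \<noteq> 0"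
    and \<phi>: "(\<phi> has_field_derivative \<mu>) (at p)" "\<mu> \<noteq> 0" "\<phi> p = p"
    and \<psi>: "isCont \<psi> p"
    and eq: "eventually (\<lambda>z. \<psi> z * f (\<phi> z) = f z) (at p)"
  shows "\<psi> p * \<mu> powi k = 1"
proof -
  have quot: "((\<lambda>z. (\<phi> z - p) / (z - p)) \<longlongrightarrow> \<mu>) (at p)"
    using \<phi>(1) unfolding has_field_derivative_iff \<phi>(3) .
  have "eventually (\<lambda>z. (\<phi> z - p) / (z - p) \<noteq> 0) (at p)"
    using tendsto_imp_eventually_ne[OF quot \<phi>(2)] .
  \<comment> \<open>The nonzero multiplier keeps \<phi> z away from p, so the factorization of f off
    p may be used at \<phi> z too.\<close>
  then have ne: "eventually (\<lambda>z. \<phi> z \<noteq> p) (at p)" by eventually_elim auto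
  have contphi: "(\<phi> \<longlongrightarrow> p) (at p)"
    using DERIV_isCont[OF \<phi>(1)] \<phi>(3) by (simp add: isCont_def)
  have lim\<phi>: "filterlim \<phi> (at p) (at p)"
    using contphi ne by (rule filterlim_atI)
  have f\<phi>: "eventually (\<lambda>z. f (\<phi> z) = (\<phi> z - p) powi k * g (\<phi> z)) (at p)"
    using filterlim_iff[THEN iffD1, OF lim\<phi>, rule_format, OF f] .
  have ev: "eventually (\<lambda>z. \<psi> z * ((\<phi> z - p) / (z - p)) powi k * g (\<phi> z) = g z) (at p)"
    using eq f f\<phi> eventually_neq_at_within[of p p UNIV]
  proof eventually_elim
    case (elim z)
    then have "\<psi> z * ((\<phi> z - p) powi k * g (\<phi> z)) = (z - p) powi k * g z" by simp
    then show ?case using elim(4) by (simp add: power_int_divide_distrib field_simps)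
  qed
  have g': "(g \<longlongrightarrow> g p) (at p)" using analytic_at_imp_isCont[OF g(1)] by (simp add: isCont_def)
  have "((\<lambda>z. \<psi> z * ((\<phi> z - p) / (z - p)) powi k * g (\<phi> z)) \<longlongrightarrow> \<psi> p * \<mu> powi k * g p) (at p)"
    using \<psi> \<phi>(2) by (intro tendsto_intros quot filterlim_compose[OF g' lim\<phi>]) (auto simp: isCont_def)
  then have "(g \<longlongrightarrow> \<psi> p * \<mu> powi k * g p) (at p)"
    using ev by (rule Lim_transform_eventually)
  from LIM_unique[OF g' this] show ?thesis using g(2) by simp
qed

subsection \<open>Continuation from the cusp\<close>

lemma q_pow_shift: "q_pow 1 (z + 1) = q_pow 1 z"
  by (simp add: q_pow_def algebra_simps exp_add)

text \<open>The series in q has period 1, so only q^(2 s) matters. It picks up exp(4 pi i s), which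
  is exp(pi i n) or its inverse, hence -1 for odd n.\<close>

lemma q_series_square_shift:
  assumes "odd n" "s = of_nat n / 4 \<or> s = - of_nat n / 4"
  shows "q_series s A (z + 1) ^ 2 = - (q_series s A z ^ 2)"
proof -
  have n: "exp (complex_of_real pi * \<i> * of_nat n) = -1"
    using assms(1) exp_of_nat_mult[of n "complex_of_real pi * \<i>"] by (simp add: mult_ac)
  have "q_pow s (z + 1) ^ 2 = exp (2 * (2 * of_real pi * \<i> * s * z) + 4 * of_real pi * \<i> * s)"
    by (simp add: q_pow_def power2_eq_square algebra_simps flip: exp_add)
  also have "\<dots> = q_pow s z ^ 2 * exp (4 * of_real pi * \<i> * s)"
    by (simp only: q_pow_def exp_add exp_double)
  also have "exp (4 * of_real pi * \<i> * s) = -1"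
    using assms(2)
  proof
    assume "s = of_nat n / 4"
    then have e: "4 * of_real pi * \<i> * s = complex_of_real pi * \<i> * of_nat n" by (simp add: field_simps)
    show ?thesis unfolding e by (rule n)
  next
    assume "s = - of_nat n / 4"
    then have "4 * s = - of_nat n" by simp
    then have "of_real pi * \<i> * (4 * s) = - (complex_of_real pi * \<i> * of_nat n)"
      by (simp only: mult_minus_right)
    then have e: "4 * of_real pi * \<i> * s = - (complex_of_real pi * \<i> * of_nat n)"
      by (simp only: mult_ac)
    show ?thesis unfolding e exp_minus n by simp
  qed
  finally show ?thesis by (simp add: q_series_def q_pow_shift power_mult_distrib)
qed

lemma norm_q_pow: "norm (q_pow 1 z) = exp (- 2 * pi * Im z)"
  by (simp add: q_pow_def)

lemma q_series_nonzero:
  assumes "fps_nth A 0 = 1" "fps_conv_radius A > 0"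
  shows "eventually (\<lambda>z. q_series s A z \<noteq> 0) at_ii_inf"
proof -
  have "isCont (eval_fps A) 0"
    using assms(2) by (intro continuous_eval_fps) (auto simp: zero_ereal_def)
  then have "\<exists>e>0. \<forall>w. dist 0 w < e \<longrightarrow> eval_fps A w \<noteq> 0"
    using assms(1) by (intro continuous_at_avoid) (auto simp: eval_fps_at_0)
  then obtain e where e: "e > 0" "\<And>w. norm w < e \<Longrightarrow> eval_fps A w \<noteq> 0" by auto
  show ?thesis
    unfolding eventually_filtercomap_at_top_dense
  proof (intro exI allI impI)
    fix z assume "Im z > - ln e / (2 * pi)"
    then have "- 2 * pi * Im z < ln e" by (simp add: field_simps)
    then have "norm (q_pow 1 z) < e" using e(1) unfolding norm_q_pow by (metis exp_less_cancel_iff exp_ln)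
    then show "q_series s A z \<noteq> 0" using e(2) by (simp add: q_series_def q_pow_def)
  qed
qed

lemma half_plane:
  assumes "Y \<ge> 0"
  shows "open {z. Im z > Y}" "convex {z. Im z > Y}" "{z. Im z > Y} \<subseteq> uhp" "{z. Im z > Y} \<noteq> {}"
proof -
  show "open {z. Im z > Y}" by (rule open_halfspace_Im_gt)
  show "convex {z. Im z > Y}" by (rule convex_halfspace_Im_gt)
  show "{z. Im z > Y} \<subseteq> uhp" using assms by (auto simp: uhp_def)
  have "Complex 0 (Y + 1) \<in> {z. Im z > Y}" by simp
  then show "{z. Im z > Y} \<noteq> {}" by blast
qed

context
  fixes Q :: "complex \<Rightarrow> complex"
  assumes mer: "Q meromorphic_on uhp"
begin

lemma sing_identity:
  assumes f: "f holomorphic_on uhp - sing Q" and g: "g holomorphic_on uhp - sing Q"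
    and S: "open S" "S \<noteq> {}" "S \<subseteq> uhp" "\<And>z. z \<in> S - sing Q \<Longrightarrow> f z = g z"
    and z: "z \<in> uhp - sing Q"
  shows "f z = g z"
proof (rule analytic_continuation_open[where s = "S - sing Q" and s' = "uhp - sing Q" and f = f and g = g])
  have mS: "Q meromorphic_on S" by (rule meromorphic_on_subset[OF mer S(3)])
  show "open (S - sing Q)" by (rule open_diff_sing[OF S(1) mS])
  show "S - sing Q \<noteq> {}" by (rule diff_sing_nonempty[OF S(1,2) mS])
  show "open (uhp - sing Q)" by (rule open_diff_sing[OF open_uhp mer])
  show "connected (uhp - sing Q)" 
    by (rule connected_diff_sing[OF open_uhp convex_connected[OF convex_uhp] mer])
qed (use assms in auto)

lemma sym2_solution_zero_everywhere:
  assumes f: "sym2_solution Q uhp f" and p: "p \<in> uhp" "eventually (\<lambda>z. f z = 0) (at p)"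
    and z: "z \<in> uhp - sing Q"
  shows "f z = 0"
proof -
  obtain r where r: "r > 0" "\<And>z. z \<in> ball p r - {p} \<Longrightarrow> f z = 0"
    using p(2) unfolding eventually_at_iff_punctured_ball by blast
  show ?thesis
  proof (rule sing_identity[where S = "(ball p r - {p}) \<inter> uhp" and g = "\<lambda>_. 0", OF _ _ _ _ _ _ z])
    show "f holomorphic_on uhp - sing Q" by (rule sym2_solution_holomorphic[OF f])
    show "open ((ball p r - {p}) \<inter> uhp)"
      by (intro open_Int open_Diff open_ball closed_singleton open_uhp)
    have "eventually (\<lambda>w. w \<in> ball p r - {p} \<and> w \<in> uhp) (at p)"
      using r(1) p(1) by (intro eventually_conj eventually_at_in_open eventually_at_in_open') auto
    then show "(ball p r - {p}) \<inter> uhp \<noteq> {}"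
      using eventually_happens'[OF at_neq_bot] by fast
  qed (use r in auto)
qed

context
  assumes QT: "\<And>z. z \<in> uhp \<Longrightarrow> Q (z + 1) = Q z"
begin

lemma shift_sing:
  assumes z: "z \<in> uhp - sing Q"
  shows "z + 1 \<in> uhp - sing Q"
proof -
  have uhp: "z + 1 \<in> uhp" using z in_uhp_shift by auto
  have "(\<lambda>w. w - 1) analytic_on {z + 1}" by (intro analytic_intros)
  then have "(\<lambda>w. Q (w - 1)) analytic_on {z + 1}"
    using analytic_on_compose_gen[of "\<lambda>w. w - 1" "{z + 1}" Q "{z}"] z by (auto simp: o_def sing_def)
  also have "?this \<longleftrightarrow> Q analytic_on {z + 1}"
  proof (rule analytic_at_cong[OF _ refl])
    have "eventually (\<lambda>w. w \<in> (\<lambda>w. w + 1) ` uhp) (nhds (z + 1))"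
      using z by (intro eventually_nhds_in_open open_translation_subtract) (auto simp: open_translation add.commute[of _ 1])
    then show "eventually (\<lambda>w. Q (w - 1) = Q w) (nhds (z + 1))"
      by eventually_elim (use QT in auto)
  qed
  finally show ?thesis using uhp by (simp add: sing_def)
qed

text \<open>The data of y^2 at one regular point near the cusp are extended by \<open>ext\<close>,
  and the relations valid there spread by the identity theorem. The values of f on
  \<open>sing Q\<close> are arbitrary, so agreement with y^2 on a whole neighbourhood of the cusp is
  stated after \<open>remove_sings\<close>.\<close>

lemma continuation_of_square:
  assumes ext: "all_data_extend Q uhp"
    and sol: "normalized_solution_ii_inf Q s A" and n: "odd n" "s = of_nat n / 4 \<or> s = - of_nat n / 4"
  obtains f where "sym2_solution Q uhp f"
    "eventually (\<lambda>z. remove_sings f z = q_series s A z ^ 2) at_ii_inf"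
    "\<And>z. z \<in> uhp - sing Q \<Longrightarrow> f (z + 1) = - f z"
    "\<And>z. z \<in> uhp - sing Q \<Longrightarrow> 2 * f z * deriv (deriv f) z - (deriv f z) ^ 2 = 4 * Q z * (f z) ^ 2"
    "\<And>p. p \<in> uhp \<Longrightarrow> \<not> eventually (\<lambda>z. f z = 0) (at p)"
proof -
  obtain Y0 where Y0: "ode_solution_on Q (q_series s A) {z. Im z > Y0}" and A: "fps_nth A 0 = 1" "fps_conv_radius A > 0"
    using sol unfolding normalized_solution_ii_inf_def by blast
  define y where "y = q_series s A"
  define Y where "Y = max Y0 0"
  define H where "H = {z. Im z > Y}"
  have H: "open H" "convex H" "H \<subseteq> uhp" "H \<noteq> {}" 
    unfolding H_def by (rule half_plane; simp add: Y_def)+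
  have "y holomorphic_on {z. Im z > Y0}" using Y0 by (simp add: ode_solution_on_def y_def)
  then have y: "y holomorphic_on H" by (rule holomorphic_on_subset) (auto simp: H_def Y_def)
  have y_ode: "deriv (deriv y) z = Q z * y z" if "z \<in> H" for z
    using Y0 that by (simp add: ode_solution_on_def y_def H_def Y_def numeral_2_eq_2)
  have mH: "Q meromorphic_on H" by (rule meromorphic_on_subset[OF mer H(3)])
  have an: "(\<lambda>z. y z ^ 2) analytic_on {z}" if "z \<in> H" for z
    using y that H(1) by (intro analytic_intros) (auto simp: analytic_at)
  have y2: "sym2_solution Q H (\<lambda>z. y z ^ 2)"
    unfolding sym2_solution_def
  proof (intro conjI ballI)
    show "(\<lambda>z. y z ^ 2) meromorphic_on H"
      using an analytic_on_analytic_at[of "\<lambda>z. y z ^ 2" H] by (intro analytic_on_imp_meromorphic_on) blast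
    show "sym2_at Q (\<lambda>z. y z ^ 2) z" if "z \<in> H - sing Q" for z
      using square_of_solution(1)[OF H(1) _ y y_ode] that by (auto simp: sing_def)
  qed
  obtain z0 where z0: "z0 \<in> H - sing Q" using diff_sing_nonempty[OF H(1,4) mH] by blast
  then obtain f where f: "sym2_solution Q uhp f" "data_at f z0 = data_at (\<lambda>z. y z ^ 2) z0"
    using ext H(3) unfolding all_data_extend_def by blast
  have fy: "f z = y z ^ 2" if "z \<in> H - sing Q" for z
    using H(1) convex_connected[OF H(2)] mH z0 sym2_solution_subset[OF f(1) H(3)] y2 f(2) that
    by (rule sym2_solution_unique)
  note fhol = sym2_solution_holomorphic[OF f(1)]
  have op: "open (uhp - sing Q)" by (rule open_diff_sing[OF open_uhp mer])
  have fy_near: "eventually (\<lambda>w. f w = y w ^ 2) (nhds z)" if "z \<in> H - sing Q" for z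
    using eventually_nhds_in_open[OF open_diff_sing[OF H(1) mH] that]
    by eventually_elim (rule fy)
  show thesis
  proof (rule that[OF f(1)])
    have "remove_sings f z = y z ^ 2" if z: "z \<in> H" for z
    proof -
      have "eventually (\<lambda>w. w \<notin> sing Q) (at z)"
        using z by (intro eventually_not_sing meromorphic_on_subset[OF mH]) auto
      with eventually_at_in_open'[OF H(1) z] have "eventually (\<lambda>w. f w = y w ^ 2) (at z)"
        by eventually_elim (simp add: fy)
      then have "remove_sings f z = remove_sings (\<lambda>w. y w ^ 2) z" by (rule remove_sings_cong) simp
      also have "\<dots> = y z ^ 2" by (rule remove_sings_at_analytic[OF an[OF z]])
      finally show ?thesis .
    qed
    then show "eventually (\<lambda>z. remove_sings f z = q_series s A z ^ 2) at_ii_inf"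
      unfolding eventually_filtercomap_at_top_dense by (intro exI[of _ Y]) (auto simp: H_def y_def)
  next
    fix z assume z: "z \<in> uhp - sing Q"
    show "f (z + 1) = - f z"
    proof (rule sing_identity[where f = "\<lambda>z. f (z + 1)" and g = "\<lambda>z. - f z", OF _ _ H(1,4,3) _ z])
      show "(\<lambda>z. f (z + 1)) holomorphic_on uhp - sing Q"
      proof (rule holomorphic_on_compose_gen[of "\<lambda>z. z + 1" "uhp - sing Q" f "uhp - sing Q", unfolded o_def])
        show "(\<lambda>z. z + 1) ` (uhp - sing Q) \<subseteq> uhp - sing Q" using shift_sing by blast
      qed (intro holomorphic_intros fhol)+
      show "(\<lambda>z. - f z) holomorphic_on uhp - sing Q" by (intro holomorphic_intros fhol)
      fix z assume z: "z \<in> H - sing Q"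
      have "z + 1 \<in> H" using z by (simp add: H_def)
      moreover have "z + 1 \<notin> sing Q" using shift_sing[of z] z H(3) by auto
      ultimately show "f (z + 1) = - f z"
        using q_series_square_shift[OF n, of A z] fy[of z] fy[of "z + 1"] z by (simp add: y_def)
    qed
  next
    fix z assume z: "z \<in> uhp - sing Q"
    have "Q analytic_on (uhp - sing Q)"
      unfolding analytic_on_analytic_at[of Q "uhp - sing Q"] by (auto simp: sing_def)
    then have Qhol: "Q holomorphic_on uhp - sing Q" by (rule analytic_imp_holomorphic)
    show "2 * f z * deriv (deriv f) z - (deriv f z) ^ 2 = 4 * Q z * (f z) ^ 2"
    proof (rule sing_identity[where f = "\<lambda>z. 2 * f z * deriv (deriv f) z - (deriv f z) ^ 2" 
          and g = "\<lambda>z. 4 * Q z * (f z) ^ 2", OF _ _ H(1,4,3) _ z])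
      show "(\<lambda>z. 2 * f z * deriv (deriv f) z - (deriv f z) ^ 2) holomorphic_on uhp - sing Q"
        by (intro holomorphic_intros holomorphic_deriv fhol op)
      show "(\<lambda>z. 4 * Q z * (f z) ^ 2) holomorphic_on uhp - sing Q"
        by (intro holomorphic_intros fhol Qhol)
      fix z assume z: "z \<in> H - sing Q"
      have "Q analytic_on {z}" using z by (simp add: sing_def)
      note sq = square_of_solution(2)[OF H(1) _ y y_ode this]
      show "2 * f z * deriv (deriv f) z - (deriv f z) ^ 2 = 4 * Q z * (f z) ^ 2"
        using sq z sym2_at_cong(2,3)[OF fy_near[OF z]] fy[OF z] by simp
    qed
  next
    fix p assume p: "p \<in> uhp"
    show "\<not> eventually (\<lambda>z. f z = 0) (at p)"
    proof
      assume "eventually (\<lambda>z. f z = 0) (at p)"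
      note zero = sym2_solution_zero_everywhere[OF f(1) p this]
      obtain M where M: "\<And>z. Im z > M \<Longrightarrow> y z \<noteq> 0"
        using q_series_nonzero[OF A] unfolding eventually_filtercomap_at_top_dense y_def by blast
      define S where "S = {z. Im z > max M Y}"
      have S: "open S" "S \<subseteq> H" "S \<noteq> {}"
        using half_plane(1,4)[of "max M Y"] by (auto simp: S_def H_def Y_def)
      have "Q meromorphic_on S" by (rule meromorphic_on_subset[OF mH S(2)])
      then obtain z where z: "z \<in> S - sing Q" using diff_sing_nonempty[OF S(1,3)] by blast
      then have "z \<in> H - sing Q" "z \<in> uhp - sing Q" using S(2) H(3) by auto
      then have "y z = 0" using zero fy by fastforce
      moreover have "y z \<noteq> 0" using z by (intro M) (auto simp: S_def)
      ultimately show False by simp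
    qed
  qed
qed

end

end

subsection \<open>The antiinvariant combination\<close>

lemma T_mat_action [simp]: "moebius T_mat z = z + 1" "autom_factor T_mat z = 1"
  by (simp_all add: moebius_def autom_factor_def T_mat_def)

lemma S_mat_action [simp]: "moebius S_mat z = - 1 / z" "autom_factor S_mat z = z"
  by (simp_all add: moebius_def autom_factor_def S_mat_def)

lemma T_mat_SL2Z: "T_mat \<in> SL2Z" and S_mat_SL2Z: "S_mat \<in> SL2Z"
  by (simp_all add: SL2Z_def T_mat_def S_mat_def det_2)

text \<open>\<open>rho\<close> is fixed by TS, that is by z -> 1 - 1/z, whose derivative there is
  1/rho^2. The values of rho^3 and rho^2 make this a primitive cube root of unity.\<close>

lemma rho_facts: "rho \<in> uhp" "rho ^ 2 = rho - 1" "rho ^ 3 = -1" "1 - 1 / rho = rho" "rho ^ 2 \<noteq> 1" "rho \<noteq> 0"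
proof -
  show "rho \<in> uhp" by (simp add: uhp_def rho_def)
  then show nz: "rho \<noteq> 0" by (rule uhp_nonzero)
  show sq: "rho ^ 2 = rho - 1"
    by (simp add: rho_def complex_eq_iff power2_eq_square field_simps)
  show "rho ^ 3 = -1"
  proof -
    have "rho ^ 3 = rho * rho ^ 2" by (simp add: power3_eq_cube power2_eq_square)
    also have "\<dots> = rho ^ 2 - rho" by (subst sq) (simp add: algebra_simps power2_eq_square)
    also have "\<dots> = -1" by (simp add: sq)
    finally show ?thesis .
  qed
  show "1 - 1 / rho = rho" using nz sq by (simp add: field_simps power2_eq_square)
  show "rho ^ 2 \<noteq> 1" unfolding sq by (simp add: rho_def complex_eq_iff)
qed

lemma cube_root_power_int_eq_1:
  fixes \<omega> :: complex
  assumes "\<omega> ^ 3 = 1" "\<omega> \<noteq> 1" "\<omega> powi j = 1"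
  shows "3 dvd j"
proof -
  have nz: "\<omega> \<noteq> 0" using assms(1) by auto
  define r where "r = nat (j mod 3)"
  have r: "int r = j mod 3" by (simp add: r_def)
  have "j = 3 * (j div 3) + int r" using r by simp
  then have "\<omega> powi j = \<omega> powi (3 * (j div 3)) * \<omega> ^ r"
    using nz by (metis power_int_add power_int_of_nat)
  also have "\<omega> powi (3 * (j div 3)) = 1"
    using assms(1) by (simp add: power_int_mult)
  finally have "\<omega> ^ r = 1" using assms(3) by simp
  moreover have "r < 3" using r by linarith
  moreover have "\<omega> ^ 2 \<noteq> 1"
  proof
    assume "\<omega> ^ 2 = 1"
    then show False using assms(1,2) by (simp add: power3_eq_cube power2_eq_square)
  qed
  ultimately have "r = 0" using assms(2) by (auto simp: less_Suc_eq numeral_eq_Suc)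
  then show ?thesis using r by presburger
qed

text \<open>A nonvanishing analytic factor preserves both existence and failure of a finite limit,
  so the convention of value 0 without a limit is respected.\<close>

lemma remove_sings_mult_analytic:
  assumes "a analytic_on {z}" "a z \<noteq> 0"
  shows "remove_sings (\<lambda>w. a w * f w) z = a z * remove_sings f z"
proof -
  have a: "(a \<longlongrightarrow> a z) (at z)"
    using analytic_at_imp_isCont[OF assms(1)] by (simp add: isCont_def)
  have ne: "eventually (\<lambda>w. a w \<noteq> 0) (at z)" using a assms(2) by (rule tendsto_imp_eventually_ne)
  show ?thesis
  proof (cases "\<exists>c. f \<midarrow>z\<rightarrow> c")
    case True
    then obtain c where c: "f \<midarrow>z\<rightarrow> c" by blast
    have "(\<lambda>w. a w * f w) \<midarrow>z\<rightarrow> a z * c" by (intro tendsto_intros a c)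
    then show ?thesis using c by (metis remove_sings_eqI)
  next
    case False
    have "\<not> (\<exists>d. (\<lambda>w. a w * f w) \<midarrow>z\<rightarrow> d)"
    proof
      assume "\<exists>d. (\<lambda>w. a w * f w) \<midarrow>z\<rightarrow> d"
      then obtain d where "(\<lambda>w. a w * f w) \<midarrow>z\<rightarrow> d" by blast
      then have "(\<lambda>w. a w * f w / a w) \<midarrow>z\<rightarrow> d / a z" by (intro tendsto_intros a assms(2))
      moreover have "eventually (\<lambda>w. a w * f w / a w = f w) (at z)"
        using ne by eventually_elim simp
      ultimately have "f \<midarrow>z\<rightarrow> d / a z" by (rule Lim_transform_eventually)
      then show False using False by blast
    qed
    then show ?thesis using False by (simp add: remove_sings_def)
  qed
qed

lemma filtermap_inverse_at:
  fixes z :: complex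
  assumes "z \<noteq> 0"
  shows "filtermap (\<lambda>w. - 1 / w) (at z) = at (- 1 / z)"
proof -
  have *: "filterlim (\<lambda>w. - 1 / w) (at (- 1 / z)) (at z)" if "z \<noteq> 0" for z :: complex
  proof (rule filterlim_atI)
    show "((\<lambda>w. - 1 / w) \<longlongrightarrow> - 1 / z) (at z)" using that by (intro tendsto_intros)
    show "eventually (\<lambda>w. - 1 / w \<noteq> - 1 / z) (at z)"
      using eventually_neq_at_within[of z z UNIV] by eventually_elim (use that in \<open>auto simp: field_simps\<close>)
  qed
  show ?thesis
  proof (rule filtermap_fun_inverse[where g = "\<lambda>w. - 1 / w"])
    show "filterlim (\<lambda>w. - 1 / w) (at (- 1 / z)) (at z)" using *[OF assms] .
    show "filterlim (\<lambda>w. - 1 / w) (at z) (at (- 1 / z))" using *[of "- 1 / z"] assms by simp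
    show "eventually (\<lambda>w. - 1 / (- 1 / w) = w) (at (- 1 / z))"
      by simp
  qed
qed

lemma eventually_regular:
  assumes "Q meromorphic_on uhp" "p \<in> uhp"
  shows "eventually (\<lambda>z. z \<in> uhp - sing Q) (at p)"
proof -
  have "Q meromorphic_on {p}" using assms by (auto intro: meromorphic_on_subset)
  from eventually_not_sing[OF this] eventually_at_in_open'[OF open_uhp assms(2)]
  show ?thesis by eventually_elim auto
qed

text \<open>With m = 2 kappa_p the double-pole coefficient is kappa_p^2 - 1/4. The indicial roots
  become 1, 1 + m and 1 - m.\<close>

lemma indicial_discriminant: "4 * ((of_nat m ^ 2 - 1) / 4) + 1 = (of_nat m ^ 2 :: complex)"
  by (simp add: field_simps)

context
  fixes Q :: "complex \<Rightarrow> complex" and m :: "complex \<Rightarrow> nat"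
  assumes mer: "Q meromorphic_on uhp"
    and QS: "\<And>z. z \<in> uhp \<Longrightarrow> Q (- 1 / z) = z ^ 4 * Q z"
    and lim: "\<And>p. p \<in> uhp \<Longrightarrow> ((\<lambda>z. (z - p) ^ 2 * Q z) \<longlongrightarrow> (of_nat (m p) ^ 2 - 1) / 4) (at p)"
    and m_i: "odd (m \<i>)" and m_rho: "\<not> 3 dvd m rho"
begin

text \<open>At i the map -1/z has derivative -1 and the factor z^2 equals -1, so an invariant
  solution has odd order k. The roots 1 + m and 1 - m are even for odd m, which leaves k =
  1.\<close>

lemma slash_S_invariant_order:
  assumes g: "sym2_solution Q uhp g" "\<And>z. z \<in> uhp \<Longrightarrow> slash_S g z = g z"
    and nz: "\<not> eventually (\<lambda>z. g z = 0) (at \<i>)"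
  obtains h where "h analytic_on {\<i>}" "h \<i> \<noteq> 0" "eventually (\<lambda>z. g z = (z - \<i>) * h z) (at \<i>)"
proof -
  have i: "\<i> \<in> uhp" by (simp add: uhp_def)
  have "g meromorphic_on {\<i>}"
    using g(1) i by (auto simp: sym2_solution_def intro: meromorphic_on_subset)
  then obtain k h where h: "h analytic_on {\<i>}" "h \<i> \<noteq> 0" "eventually (\<lambda>z. g z = (z - \<i>) powi k * h z) (at \<i>)"
    using meromorphic_at_factorization[OF _ nz] by blast
  have "((\<lambda>z::complex. - 1 / z) has_field_derivative -1) (at \<i>)"
    by (auto intro!: derivative_eq_intros)
  moreover have "isCont (\<lambda>z::complex. z ^ 2) \<i>" by (intro continuous_intros)
  moreover have "eventually (\<lambda>z. z ^ 2 * g (- 1 / z) = g z) (at \<i>)"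
    using eventually_regular[OF mer i] by eventually_elim (use g(2) in \<open>auto simp: slash_S_def\<close>)
  ultimately have "\<i> ^ 2 * (-1) powi k = (1::complex)"
    using fixed_point_multiplier[OF h(3,1,2), of "\<lambda>z. - 1 / z" "-1" "\<lambda>z. z ^ 2"] by auto
  then have k: "odd k" by (auto simp: power_int_minus_left)
  have ode: "eventually (\<lambda>z. deriv (deriv (deriv g)) z = 4 * Q z * deriv g z + 2 * deriv Q z * g z) (at \<i>)"
    using eventually_regular[OF mer i] by eventually_elim (use g(1) in \<open>auto simp: sym2_solution_def sym2_at_def\<close>)
  have "Q meromorphic_on {\<i>}" using i by (intro meromorphic_on_subset[OF mer]) auto
  from indicial_equation[OF this lim[OF i] h ode, unfolded indicial_discriminant]
  have "of_int ((k - 1) * ((k - 1) ^ 2 - int (m \<i>) ^ 2)) = (0::complex)" by simp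
  then have "(k - 1) * ((k - 1) ^ 2 - int (m \<i>) ^ 2) = 0" by (simp only: of_int_eq_0_iff)
  then have "k = 1 \<or> (k - 1) ^ 2 = int (m \<i>) ^ 2" by auto
  moreover have "even ((k - 1) ^ 2)" "odd (int (m \<i>) ^ 2)" using k m_i by auto
  ultimately have "k = 1" by metis
  then show thesis using that h by simp
qed

text \<open>The signs of S and T cancel in TS, so f would be TS-invariant and k - 1 divisible by 3.
  The equation of squares gives (k - 1)^2 = m^2, contradicting the hypothesis on m at
  \<open>rho\<close>.\<close>

lemma square_not_slash_S_antiinvariant:
  assumes f: "sym2_solution Q uhp f" "\<And>z. z \<in> uhp - sing Q \<Longrightarrow> f (z + 1) = - f z"
    and sq: "\<And>z. z \<in> uhp - sing Q \<Longrightarrow> 2 * f z * deriv (deriv f) z - (deriv f z) ^ 2 = 4 * Q z * (f z) ^ 2"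
    and nz: "\<not> eventually (\<lambda>z. f z = 0) (at rho)"
    and anti: "\<And>z. z \<in> uhp - sing Q \<Longrightarrow> slash_S f z = - f z"
  shows False
proof -
  note rho = rho_facts(1)
  have "f meromorphic_on {rho}"
    using f(1) rho by (auto simp: sym2_solution_def intro: meromorphic_on_subset)
  then obtain k h where h: "h analytic_on {rho}" "h rho \<noteq> 0" "eventually (\<lambda>z. f z = (z - rho) powi k * h z) (at rho)"
    using meromorphic_at_factorization[OF _ nz] by blast
  have d: "((\<lambda>z::complex. 1 - 1 / z) has_field_derivative 1 / rho ^ 2) (at rho)"
    using rho_facts(6) by (auto intro!: derivative_eq_intros simp: power2_eq_square)
  have c: "isCont (\<lambda>z::complex. z ^ 2) rho" by (intro continuous_intros)
  have e: "eventually (\<lambda>z. z ^ 2 * f (1 - 1 / z) = f z) (at rho)"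
    using eventually_regular[OF mer rho]
  proof eventually_elim
    case (elim z)
    have "f (1 - 1 / z) = - f (- 1 / z)"
      using f(2)[OF weight_four_inverse_sing[OF QS elim]] by simp
    then show ?case using anti[OF elim] by (simp add: slash_S_def)
  qed
  have "1 / rho ^ 2 \<noteq> 0" using rho_facts(6) by simp
  from fixed_point_multiplier[OF h(3,1,2) d this rho_facts(4) c e]
  have "rho ^ 2 * (1 / rho ^ 2) powi k = 1" .
  \<comment> \<open>The automorphy factor rho^2 is the inverse of the multiplier and cancels one of
    its k powers.\<close>
  moreover have "(1 / rho ^ 2) powi k = (1 / rho ^ 2) powi (k - 1) * (1 / rho ^ 2)"
    using power_int_add_1[of "1 / rho ^ 2" "k - 1"] rho_facts(6) by simp
  ultimately have "(1 / rho ^ 2) powi (k - 1) = 1" using rho_facts(6) by simp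
  moreover have "(1 / rho ^ 2) ^ 3 = 1 / (rho ^ 3) ^ 2"
    by (simp add: power_divide flip: power_mult)
  then have "(1 / rho ^ 2) ^ 3 = 1" using rho_facts(3) by simp
  moreover have "1 / rho ^ 2 \<noteq> 1" using rho_facts(5) by (simp add: divide_eq_1_iff)
  ultimately have k: "3 dvd k - 1" by (intro cube_root_power_int_eq_1)
  have ode: "eventually (\<lambda>z. 2 * f z * deriv (deriv f) z - (deriv f z) ^ 2 = 4 * Q z * (f z) ^ 2) (at rho)"
    using eventually_regular[OF mer rho] by eventually_elim (rule sq)
  have "Q meromorphic_on {rho}" using rho by (intro meromorphic_on_subset[OF mer]) auto
  from indicial_equation_square[OF this lim[OF rho] h ode, unfolded indicial_discriminant]
  have "of_int ((k - 1) ^ 2) = (of_int (int (m rho) ^ 2) :: complex)" by simp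
  then have "(k - 1) ^ 2 = int (m rho) ^ 2" by (simp only: of_int_eq_iff)
  moreover have "3 dvd (k - 1) ^ 2" using k by (simp add: power2_eq_square)
  ultimately have "3 dvd (m rho) ^ 2" by (metis int_dvd_int_iff of_nat_numeral of_nat_power)
  moreover have "prime (3::nat)" by simp
  ultimately have "3 dvd m rho" by (rule prime_dvd_power[rotated])
  then show False using m_rho by simp
qed

lemma exists_antiinvariant_combination:
  assumes fp: "sym2_solution Q uhp fp" "\<And>z. z \<in> uhp - sing Q \<Longrightarrow> fp (z + 1) = - fp z"
    and sq: "\<And>z. z \<in> uhp - sing Q \<Longrightarrow> 2 * fp z * deriv (deriv fp) z - (deriv fp z) ^ 2 = 4 * Q z * (fp z) ^ 2"
    and nz: "\<not> eventually (\<lambda>z. fp z = 0) (at rho)"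
    and fm: "sym2_solution Q uhp fm"
  obtains c where "\<And>z. z \<in> uhp - sing Q \<Longrightarrow> slash_S (\<lambda>w. fm w + c * fp w) z = - (fm z + c * fp z)"
proof -
  have i: "\<i> \<in> uhp" by (simp add: uhp_def)
  \<comment> \<open>The operator 1 + S maps into the invariants of S. The factors \<open>1 *\<close>
    give it the shape of the linear combination lemma.\<close>
  define sym where "sym = (\<lambda>f z. 1 * f z + 1 * slash_S f z)"
  have sym: "sym2_solution Q uhp (sym f)" if "sym2_solution Q uhp f" for f
    unfolding sym_def using that sym2_solution_slash_S[OF QS that] by (rule sym2_solution_linear_combination)
  have inv: "slash_S (sym f) z = sym f z" if "z \<in> uhp" for f z
  proof -
    have "slash_S (sym f) z = slash_S f z + slash_S (slash_S f) z"
      by (simp add: sym_def slash_S_def[of "\<lambda>z. 1 * f z + 1 * slash_S f z"] distrib_left)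
        (simp add: slash_S_def distrib_left)
    then show ?thesis using slash_S_slash_S[OF that] by (simp add: sym_def)
  qed
  have gp_nz: "\<not> eventually (\<lambda>z. sym fp z = 0) (at \<i>)"
  proof
    assume "eventually (\<lambda>z. sym fp z = 0) (at \<i>)"
    from sym2_solution_zero_everywhere[OF mer sym[OF fp(1)] i this]
    have "slash_S fp z = - fp z" if "z \<in> uhp - sing Q" for z
      using that by (simp add: sym_def add_eq_0_iff)
    from square_not_slash_S_antiinvariant[OF fp sq nz this] show False .
  qed
  obtain hp where hp: "hp analytic_on {\<i>}" "hp \<i> \<noteq> 0" "eventually (\<lambda>z. sym fp z = (z - \<i>) * hp z) (at \<i>)"
    using slash_S_invariant_order[OF sym[OF fp(1)] inv gp_nz] by blast
  have "\<exists>hm. hm analytic_on {\<i>} \<and> eventually (\<lambda>z. sym fm z = (z - \<i>) * hm z) (at \<i>)"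
  proof (cases "eventually (\<lambda>z. sym fm z = 0) (at \<i>)")
    case True
    then show ?thesis by (intro exI[of _ "\<lambda>_. 0"]) simp
  next
    case False
    show ?thesis using slash_S_invariant_order[OF sym[OF fm] inv False] by blast
  qed
  then obtain hm where hm: "hm analytic_on {\<i>}" "eventually (\<lambda>z. sym fm z = (z - \<i>) * hm z) (at \<i>)" by blast
  \<comment> \<open>This c cancels the coefficient of z - i in
    \<open>sym fm + c sym fp\<close>.\<close>
  define c where "c = - hm \<i> / hp \<i>"
  define G where "G = (\<lambda>z. 1 * sym fm z + c * sym fp z)"
  have G: "sym2_solution Q uhp G"
    unfolding G_def using sym[OF fm] sym[OF fp(1)] by (rule sym2_solution_linear_combination)
  have G_inv: "slash_S G z = G z" if "z \<in> uhp" for z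
  proof -
    have "slash_S G z = slash_S (sym fm) z + c * slash_S (sym fp) z"
      by (simp add: G_def slash_S_def algebra_simps)
    then show ?thesis by (simp add: inv[OF that] G_def)
  qed
  \<comment> \<open>A nonzero G would be an invariant of exact order 1, but its coefficient of z - i
    has just been made 0.\<close>
  have "eventually (\<lambda>z. G z = 0) (at \<i>)"
  proof (rule ccontr)
    assume "\<not> eventually (\<lambda>z. G z = 0) (at \<i>)"
    then obtain h where h: "h analytic_on {\<i>}" "h \<i> \<noteq> 0" "eventually (\<lambda>z. G z = (z - \<i>) * h z) (at \<i>)"
      using slash_S_invariant_order[OF G G_inv] by blast
    have "eventually (\<lambda>z. h z = hm z + c * hp z) (at \<i>)"
      using h(3) hm(2) hp(3) eventually_neq_at_within[of \<i> \<i> UNIV]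
    proof eventually_elim
      case (elim z)
      then have "(z - \<i>) * h z = (z - \<i>) * (hm z + c * hp z)"
        by (simp add: G_def algebra_simps)
      then show ?case using elim(4) by simp
    qed
    moreover have "(\<lambda>z. hm z + c * hp z) \<midarrow>\<i>\<rightarrow> hm \<i> + c * hp \<i>"
      using analytic_at_imp_isCont[OF hm(1)] analytic_at_imp_isCont[OF hp(1)]
      by (intro tendsto_intros) (auto simp: isCont_def)
    ultimately have "h \<midarrow>\<i>\<rightarrow> hm \<i> + c * hp \<i>"
      by (subst tendsto_cong)
    moreover have "h \<midarrow>\<i>\<rightarrow> h \<i>" using analytic_at_imp_isCont[OF h(1)] by (simp add: isCont_def)
    ultimately have "h \<i> = hm \<i> + c * hp \<i>" by (metis LIM_unique)
    then show False using h(2) hp(2) by (simp add: c_def)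
  qed
  note G0 = sym2_solution_zero_everywhere[OF mer G i this]
  show thesis
  proof (rule that[of c])
    fix z assume z: "z \<in> uhp - sing Q"
    show "slash_S (\<lambda>w. fm w + c * fp w) z = - (fm z + c * fp z)"
      using G0[OF z] by (simp add: G_def sym_def slash_S_def algebra_simps add_eq_0_iff)
  qed
qed

end

theorem theorem1p4:
  fixes Q :: "complex \<Rightarrow> complex"
    and \<kappa> :: "complex \<Rightarrow> real"
    and n :: nat
    and A_plus A_minus :: "complex fps"
  assumes modular: "meromorphic_modular_form 4 Q"
    and fuchsian: "fuchsian Q"
    and kappa: "\<And>p. p \<in> uhp \<Longrightarrow> \<kappa> p \<ge> 0 \<and>
        local_exponents Q p = {of_real (1/2 + \<kappa> p), of_real (1/2 - \<kappa> p)}"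
    and apparent: "\<And>p. p \<in> uhp \<Longrightarrow> is_pole Q p \<Longrightarrow>
        apparent Q p \<and> (\<exists>m::nat. m \<ge> 1 \<and> \<kappa> p = real m / 2)"
    and kappa_gt: "\<And>p. p \<in> uhp \<Longrightarrow> is_pole Q p \<Longrightarrow>
        \<not> SL2Z_equiv p \<i> \<Longrightarrow> \<not> SL2Z_equiv p rho \<Longrightarrow> \<kappa> p > 1/2"
    and Q_inf: "value_at_ii_inf Q \<in> \<real>\<^sub>\<le>\<^sub>0"
    and kappa_i: "\<kappa> \<i> \<notin> \<int>"
    and kappa_rho: "2 * \<kappa> rho / 3 \<notin> \<int>"
    and n: "n > 0" "odd n"
    and exponents_inf: "local_exponents_ii_inf Q = {of_nat n / 4, - of_nat n / 4}"
    and y_plus: "normalized_solution_ii_inf Q (of_nat n / 4) A_plus"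
    and y_minus: "normalized_solution_ii_inf Q (- of_nat n / 4) A_minus"
  shows "\<exists>Y_plus Y_minus.
      meromorphic_continuation (\<lambda>z. q_series (of_nat n / 4) A_plus z ^ 2) Y_plus \<and>
      meromorphic_continuation (\<lambda>z. q_series (- of_nat n / 4) A_minus z ^ 2) Y_minus \<and>
      (\<exists>c::complex. \<forall>z\<in>uhp.
         let F = remove_sings (\<lambda>w. Y_minus w + c * Y_plus w)
         in slash (-2) F T_mat z = - F z \<and> slash (-2) F S_mat z = - F z)"
proof -
  have nice: "Q nicely_meromorphic_on uhp" and
    transf: "\<And>\<gamma> z. \<gamma> \<in> SL2Z \<Longrightarrow> z \<in> uhp \<Longrightarrow> Q (moebius \<gamma> z) = autom_factor \<gamma> z powi 4 * Q z"
    using modular by (auto simp: meromorphic_modular_form_def)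
  have mer: "Q meromorphic_on uhp" using nice by (simp add: nicely_meromorphic_on_def)
  have QT: "Q (z + 1) = Q z" if "z \<in> uhp" for z
    using transf[OF T_mat_SL2Z that] by simp
  have QS: "Q (- 1 / z) = z ^ 4 * Q z" if "z \<in> uhp" for z
    using transf[OF S_mat_SL2Z that] by simp
  have pole: "is_pole Q p" if "p \<in> uhp" "p \<in> sing Q" for p
    using nicely_meromorphic_on_imp_analytic_at[OF nice that(1)] that(2) by (auto simp: sing_def)
  have lim_kappa: "((\<lambda>z. (z - p) ^ 2 * Q z) \<longlongrightarrow> of_real (\<kappa> p) ^ 2 - 1 / 4) (at p)" if "p \<in> uhp" for p
  proof -
    have "of_real (1/2 + \<kappa> p) \<in> local_exponents Q p" using kappa[OF that] by simp
    moreover have "of_real (1/2 + \<kappa> p) * (of_real (1/2 + \<kappa> p) - 1) = (of_real (\<kappa> p) ^ 2 - 1 / 4 :: complex)"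
      by (simp add: field_simps power2_eq_square)
    ultimately show ?thesis by (simp only: local_exponents_def mem_Collect_eq)
  qed
  \<comment> \<open>At a regular point the double-pole coefficient is 0, so kappa_p = 1/2. Hence 2
    kappa_p is a positive integer at every point, including i and \<open>rho\<close> when Q is
    regular there.\<close>
  have "\<exists>m::nat. m \<ge> 1 \<and> \<kappa> p = real m / 2" if p: "p \<in> uhp" for p
  proof (cases "p \<in> sing Q")
    case True
    then show ?thesis using apparent pole p by blast
  next
    case False
    then have "isCont Q p" by (auto simp: sing_def intro: analytic_at_imp_isCont)
    then have "isCont (\<lambda>z. (z - p) ^ 2 * Q z) p" by (intro continuous_intros)
    then have "((\<lambda>z. (z - p) ^ 2 * Q z) \<longlongrightarrow> 0) (at p)" by (simp add: isCont_def)
    with lim_kappa[OF p] have "of_real (\<kappa> p) ^ 2 - 1 / 4 = (0::complex)" by (rule LIM_unique)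
    then have "complex_of_real (\<kappa> p ^ 2) = of_real (1 / 4)" by simp
    then have "\<kappa> p ^ 2 = (1 / 2) ^ 2" by (simp only: of_real_eq_iff) (simp add: power2_eq_square)
    then have "\<kappa> p = 1 / 2" using kappa[OF p] by (simp add: power2_eq_iff_nonneg)
    then show ?thesis by (intro exI[of _ 1]) auto
  qed
  then obtain m :: "complex \<Rightarrow> nat" where m: "\<And>p. p \<in> uhp \<Longrightarrow> m p \<ge> 1" "\<And>p. p \<in> uhp \<Longrightarrow> \<kappa> p = real (m p) / 2"
    by metis
  have lim: "((\<lambda>z. (z - p) ^ 2 * Q z) \<longlongrightarrow> (of_nat (m p) ^ 2 - 1) / 4) (at p)" if "p \<in> uhp" for p
    using lim_kappa[OF that] unfolding m(2)[OF that] by (simp add: field_simps)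
  have i: "\<i> \<in> uhp" by (simp add: uhp_def)
  have m_i: "odd (m \<i>)"
  proof
    assume "even (m \<i>)"
    then obtain j where "m \<i> = 2 * j" by blast
    then show False using kappa_i m(2)[OF i] by simp
  qed
  have m_rho: "\<not> 3 dvd m rho"
  proof
    assume "3 dvd m rho"
    then obtain j where "m rho = 3 * j" by blast
    then show False using kappa_rho m(2)[OF rho_facts(1)] by simp
  qed
  have "\<exists>r>0. all_data_extend Q (ball p r)" if p: "p \<in> uhp" for p
  proof (cases "p \<in> sing Q")
    case True
    have "apparent Q p" using apparent pole p True by blast
    then have no_log: "\<not> logarithmic_singularity y p"
      if "r > 0" "ode_solution_on Q y (ball p r \<inter> slit_plane p)" for r y
      using that unfolding apparent_def by blast
    have "Q meromorphic_on {p}" using p by (intro meromorphic_on_subset[OF mer]) auto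
    from all_data_extend_singular[OF this True lim[OF p] m(1)[OF p] no_log] show ?thesis .
  next
    case False
    then show ?thesis by (intro all_data_extend_regular) (simp add: sing_def)
  qed
  note ext = all_data_extend_uhp[OF mer this]
  obtain fp where fp: "sym2_solution Q uhp fp"
    "eventually (\<lambda>z. remove_sings fp z = q_series (of_nat n / 4) A_plus z ^ 2) at_ii_inf"
    "\<And>z. z \<in> uhp - sing Q \<Longrightarrow> fp (z + 1) = - fp z"
    "\<And>z. z \<in> uhp - sing Q \<Longrightarrow> 2 * fp z * deriv (deriv fp) z - (deriv fp z) ^ 2 = 4 * Q z * (fp z) ^ 2"
    "\<And>p. p \<in> uhp \<Longrightarrow> \<not> eventually (\<lambda>z. fp z = 0) (at p)"
    by (rule continuation_of_square[OF mer QT ext y_plus n(2) disjI1[OF refl]]) (assumption | rule that)+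
  obtain fm where fm: "sym2_solution Q uhp fm"
    "eventually (\<lambda>z. remove_sings fm z = q_series (- of_nat n / 4) A_minus z ^ 2) at_ii_inf"
    "\<And>z. z \<in> uhp - sing Q \<Longrightarrow> fm (z + 1) = - fm z"
    by (rule continuation_of_square[OF mer QT ext y_minus n(2) disjI2[OF refl]]) (assumption | rule that)+
  obtain c where c: "\<And>z. z \<in> uhp - sing Q \<Longrightarrow> slash_S (\<lambda>w. fm w + c * fp w) z = - (fm z + c * fp z)"
    by (rule exists_antiinvariant_combination[OF mer QS lim m_i m_rho fp(1,3,4) fp(5)[OF rho_facts(1)] fm(1)])
      (assumption | rule that)+
  define F where "F = (\<lambda>w. fm w + c * fp w)"
  \<comment> \<open>A sum of normalised functions need not be normalised, because poles can cancel.
    Both sides are normalisations of functions that agree off \<open>sing Q\<close>.\<close>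
  have F_rs: "remove_sings (\<lambda>w. remove_sings fm w + c * remove_sings fp w) z = remove_sings F z" if "z \<in> uhp" for z
  proof (rule remove_sings_cong[OF _ refl])
    show "eventually (\<lambda>w. remove_sings fm w + c * remove_sings fp w = F w) (at z)"
      using eventually_regular[OF mer that]
    proof eventually_elim
      case (elim w)
      then have "fm analytic_on {w}" "fp analytic_on {w}"
        using fm(1) fp(1) by (auto simp: sym2_solution_def sym2_at_def)
      then show ?case by (simp add: F_def)
    qed
  qed
  \<comment> \<open>The transformation law is known only off \<open>sing Q\<close>. It therefore
    holds in punctured neighbourhoods of every point, and \<open>remove_sings\<close> commutes with
    the shift.\<close>
  have T: "remove_sings F (z + 1) = - remove_sings F z" if z: "z \<in> uhp" for z
  proof -
    have "filtermap (\<lambda>w. w + 1) (at z) = at (z + 1)"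
      using filtermap_at_shift[of "-1" z] by simp
    from remove_sings_compose[OF this, of F]
    have "remove_sings F (z + 1) = remove_sings (\<lambda>w. F (w + 1)) z" by (simp add: o_def)
    also have "\<dots> = remove_sings (\<lambda>w. (-1) * F w) z"
    proof (rule remove_sings_cong[OF _ refl])
      show "eventually (\<lambda>w. F (w + 1) = (-1) * F w) (at z)"
        using eventually_regular[OF mer z]
        by eventually_elim (simp add: F_def fp(3) fm(3))
    qed
    also have "\<dots> = (-1) * remove_sings F z"
      by (rule remove_sings_mult_analytic) auto
    finally show ?thesis by simp
  qed
  have S: "z ^ 2 * remove_sings F (- 1 / z) = - remove_sings F z" if z: "z \<in> uhp" for z
  proof -
    have "remove_sings F (- 1 / z) = remove_sings (\<lambda>w. F (- 1 / w)) z"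
      using remove_sings_compose[OF filtermap_inverse_at[OF uhp_nonzero[OF z]], of F] by (simp add: o_def)
    then have "z ^ 2 * remove_sings F (- 1 / z) = remove_sings (\<lambda>w. w ^ 2 * F (- 1 / w)) z"
      using uhp_nonzero[OF z] by (subst remove_sings_mult_analytic) (auto intro!: analytic_intros)
    also have "\<dots> = remove_sings (\<lambda>w. (-1) * F w) z"
    proof (rule remove_sings_cong[OF _ refl])
      show "eventually (\<lambda>w. w ^ 2 * F (- 1 / w) = (-1) * F w) (at z)"
        using eventually_regular[OF mer z]
      proof eventually_elim
        case (elim w)
        show ?case using c[OF elim] unfolding slash_S_def F_def by simp
      qed
    qed
    also have "\<dots> = (-1) * remove_sings F z"
      by (rule remove_sings_mult_analytic) auto
    finally show ?thesis by simp
  qed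
  show ?thesis
  proof (rule exI[of _ "remove_sings fp"], rule exI[of _ "remove_sings fm"], intro conjI)
    show "meromorphic_continuation (\<lambda>z. q_series (of_nat n / 4) A_plus z ^ 2) (remove_sings fp)"
      "meromorphic_continuation (\<lambda>z. q_series (- of_nat n / 4) A_minus z ^ 2) (remove_sings fm)"
      using fp(1,2) fm(1,2) unfolding meromorphic_continuation_def sym2_solution_def
      by (auto intro: remove_sings_nicely_meromorphic)
    have "slash (- 2) R T_mat z = - R z \<and> slash (- 2) R S_mat z = - R z"
      if z: "z \<in> uhp" and R: "R = remove_sings (\<lambda>w. remove_sings fm w + c * remove_sings fp w)" for R z
      using T[OF z] S[OF z] F_rs[OF z] F_rs[OF in_uhp_shift[OF z]] F_rs[OF in_uhp_inverse[OF z]]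
      by (simp add: slash_def R)
    then show "\<exists>c. \<forall>z\<in>uhp. let F = remove_sings (\<lambda>w. remove_sings fm w + c * remove_sings fp w)
         in slash (-2) F T_mat z = - F z \<and> slash (-2) F S_mat z = - F z"
      unfolding Let_def by blast
  qed
qed

end
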